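(* Let $k\ge 2$ and let $\mathbf a=(a_1,\dots,a_k)$ and $\mathbf b=(b_1,\dots,b_k)$ be sequences of positive integers, written in nonincreasing order. If $\mathbf a\succ\mathbf b$, then \[\rho(K_{\mathbf b},K_{\mathbf a})=1.\] Furthermore, if $\|\mathbf a\|_1=\|\mathbf b\|_1$, then $\rho(K_{\mathbf b},K_{\mathbf a})=1$ holds if and only if $\mathbf a\succ\mathbf b$.
   Context: For a sequence $\mathbf a=(a_1,\dots,a_k)$ of positive integers, $K_{\mathbf a}=K_{a_1,\dots,a_k}$ is the complete $k$-partite graph with parts of sizes $a_1,\dots,a_k$, and $\|\mathbf a\|_1=\sum_i a_i$. For nonincreasing $\mathbf a,\mathbf b$ of length $k$, $\mathbf a\succ\mathbf b$ means that $\mathbf a$ majorizes $\mathbf b$: $\sum_{j=1}^i a_j\ge\sum_{j=1}^i b_j$ for every $1\le i\le k$, with equality for $i=k$ (in particular $\mathbf a\succ\mathbf a$). A graphon is a symmetric measurable function $W:[0,1]^2\to[0,1]$. For a finite simple graph $G$ with vertices $v_1,\dots,v_n$, put $t(G,W)=\int_{[0,1]^n}\prod_{v_iv_j\in E(G)}W(x_i,x_j)\,dx_1\cdots dx_n$; for a finite graph $W$ (loops allowed), $t(G,W)=\hom(G,W)/|V(W)|^{|V(G)|}$, where $\hom(G,W)$ is the number of maps $V(G)\to V(W)$ sending edges to edges. For finite simple graphs $G,H$, the density domination exponent is $\rho(G,H)=\sup_W \frac{\log t(H,W)}{\log t(G,W)}\in[0,\infty]$, where $W$ ranges over all graphons (equivalently,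 all finite graphs) with $t(G,W)\ne 0$. Conventions: those $W$ with $t(G,W)=1$, where the quotient is undefined, are omitted; $\log 0=-\infty$, so the quotient is $+\infty$ if $t(H,W)=0$. Thus, when $G$ has at least one edge, for $c>0$ one has $\rho(G,H)\le c$ if and only if $t(H,W)\ge t(G,W)^c$ for every $W$. *)

theory Defs
  imports "HOL-Analysis.Analysis"
begin

text \<open>A graph is a pair of a vertex set and a set of edges, an edge being a two-element set.\<close>

type_synonym 'v graph = "'v set \<times> 'v set set"

definition finite_simple_graph :: "'v graph \<Rightarrow> bool" where
  "finite_simple_graph G \<longleftrightarrow> finite (fst G) \<and> (\<forall>e\<in>snd G. e \<subseteq> fst G \<and> card e = 2)"

definition complete_multipartite :: "nat list \<Rightarrow> (nat \<times> nat) graph" where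
  "complete_multipartite a =
    (let V = {(i, j). i < length a \<and> j < a ! i}
     in (V, {{u, v} | u v. u \<in> V \<and> v \<in> V \<and> fst u \<noteq> fst v}))"

definition majorizes :: "nat list \<Rightarrow> nat list \<Rightarrow> bool" where
  "majorizes a b \<longleftrightarrow> length a = length b
     \<and> (\<forall>i\<in>{1..length a}. sum_list (take i b) \<le> sum_list (take i a))
     \<and> sum_list a = sum_list b"

abbreviation unit_measure :: "real measure" where
  "unit_measure \<equiv> restrict_space lborel {0..1}"

text \<open>Values of \<open>W\<close> outside the unit square are irrelevant. Measurability is Borel measurability;
  every Lebesgue measurable graphon agrees almost everywhere with a symmetric Borel one.\<close>

definition graphon :: "(real \<Rightarrow> real \<Rightarrow> real) \<Rightarrow> bool" where
  "graphon W \<longleftrightarrow>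
     (\<lambda>(x, y). W x y) \<in> borel_measurable (unit_measure \<Otimes>\<^sub>M unit_measure)
     \<and> (\<forall>x\<in>{0..1}. \<forall>y\<in>{0..1}. W x y = W y x \<and> 0 \<le> W x y \<and> W x y \<le> 1)"

text \<open>The value of a function of two arguments at an unordered pair; it is meaningful when the
  function is symmetric at that pair, see the lemma below.\<close>

definition edge_value :: "('v \<Rightarrow> 'v \<Rightarrow> real) \<Rightarrow> 'v set \<Rightarrow> real" where
  "edge_value f e = (THE r. \<exists>u v. e = {u, v} \<and> r = f u v)"

lemma edge_value_insert:
  assumes "f u v = f v u"
  shows "edge_value f {u, v} = f u v"
  unfolding edge_value_def using assms by (intro the_equality) (auto simp: doubleton_eq_iff)

definition hom_density :: "'v graph \<Rightarrow> (real \<Rightarrow> real \<Rightarrow> real) \<Rightarrow> real" where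
  "hom_density G W =
     (\<integral>x. (\<Prod>e\<in>snd G. edge_value (\<lambda>u v. W (x u) (x v)) e) \<partial>(\<Pi>\<^sub>M v\<in>fst G. unit_measure))"

text \<open>Densities of finite simple graphs lie in the unit interval, so the real quotient below is
  nonnegative and \<open>ennreal\<close> does not truncate it. The supremum is taken in \<open>[0, \<infinity>]\<close>, hence it
  is 0 if \<open>G\<close> has no edges.\<close>

definition density_domination_exponent :: "'v graph \<Rightarrow> 'w graph \<Rightarrow> ennreal" where
  "density_domination_exponent G H =
     (SUP W \<in> {W. graphon W \<and> hom_density G W \<noteq> 0 \<and> hom_density G W \<noteq> 1}.
        if hom_density H W = 0 then \<infinity>
        else ennreal (ln (hom_density H W) / ln (hom_density G W)))"

lemma finite_simple_graph_complete_multipartite: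
  "finite_simple_graph (complete_multipartite a)"
proof -
  have "{(i, j). i < length a \<and> j < a ! i} = (SIGMA i:{..<length a}. {..<a ! i})"
    by auto
  then have "finite {(i, j). i < length a \<and> j < a ! i}"
    by simp
  then show ?thesis
    by (auto simp: finite_simple_graph_def complete_multipartite_def Let_def card_2_iff)
qed

end

theory Submission
  imports Defs
begin

text \<open>
  If \<open>a\<close> majorizes \<open>b\<close>, then \<open>b\<close> arises from \<open>a\<close> by moving single vertices from a larger part to a
  part with at least two vertices fewer, so it is enough to see that one such move does not increase
  the density. Fix the vertices in all other parts; they only put a weight \<open>f\<close> on the vertices of
  the two parts. For a part of \<open>p + 1\<close> vertices and a part \<open>y\<close> of \<open>q \<le> p\<close> vertices, write \<open>h y\<close> for
  the weighted number of common neighbours of \<open>y\<close>. After the move, \<open>p\<close> vertices are adjacent to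
  \<open>q + 1\<close>; deleting \<open>p - q\<close> of the edges at the moved vertex can only help, and leaves a
  complete bipartite graph on \<open>x, y\<close> with \<open>q + q\<close> vertices, weighted by \<open>h y ^ (p - q) * h x\<close>.
  Exchanging \<open>x\<close> and \<open>y\<close> and using \<open>s ^ m * t + t ^ m * s \<le> s ^ (m + 1) + t ^ (m + 1)\<close> bounds this by
  the same integral with weight \<open>h y ^ (p - q + 1)\<close>, which is the density before the move.
  Equality of both densities for the indicator of a square shows that the exponent is not below 1.

  If conversely the \<open>i\<close> largest parts of \<open>a\<close> have fewer vertices than those of \<open>b\<close>, take a graphon
  with \<open>i\<close> large independent classes and a set of small measure \<open>\<epsilon>\<close>, all other values being 1. Each
  class receives vertices of at most one part, so the densities have the orders \<open>\<epsilon> ^ (n - S)\<close> with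
  \<open>S\<close> the sum of the \<open>i\<close> largest parts, and the density of \<open>b\<close> is the larger one.
\<close>

section \<open>Moving a vertex between two parts\<close>

text \<open>For \<open>x \<le> y\<close> with \<open>y = x + d\<close>, the right side exceeds the
  left by \<open>d\<close> times the gap between \<open>y ^ m\<close> and \<open>x ^ m\<close>. The
  proof adds \<open>d\<close> instead of subtracting, since differences of extended reals are
  awkward.\<close>

lemma mixed_power_sum_le:
  fixes s t :: ennreal
  shows "s ^ m * t + t ^ m * s \<le> s ^ Suc m + t ^ Suc m"
proof -
  have *: "x ^ m * y + y ^ m * x \<le> x ^ Suc m + y ^ Suc m" if xy: "x \<le> y" for x y :: ennreal
  proof -
    obtain d where d: "y = x + d" using xy by (auto simp: le_iff_add)
    have "x ^ m * y + y ^ m * x = x ^ Suc m + x ^ m * d + y ^ m * x"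
      by (simp add: d algebra_simps)
    also have "\<dots> \<le> x ^ Suc m + y ^ m * d + y ^ m * x"
      using xy by (intro add_mono mult_right_mono power_mono) auto
    also have "\<dots> = x ^ Suc m + y ^ Suc m"
      by (simp add: d algebra_simps)
    finally show ?thesis .
  qed
  show ?thesis
    using *[of s t] *[of t s] by (cases "s \<le> t") (auto simp: add.commute)
qed

text \<open>In both integrals the other part is already integrated out: its vertices are independent
  once \<open>y\<close> is fixed, so they contribute a power. The left side is the state after the
  move, with \<open>t\<close> the moved vertex; the right side is the state before it. Nonnegative
  extended reals allow Tonelli without any integrability condition.\<close>

lemma nn_integral_multipartite_shift:
  fixes M :: "'a measure" and w :: "'a \<Rightarrow> 'a \<Rightarrow> ennreal"
  assumes "sigma_finite_measure M"
    and f [measurable]: "f \<in> borel_measurable M"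
    and w [measurable]: "(\<lambda>(x, y). w x y) \<in> borel_measurable (M \<Otimes>\<^sub>M M)"
    and sym: "\<And>x y. w x y = w y x" and le_1: "\<And>x y. w x y \<le> 1"
    and Q: "finite Q" "t \<notin> Q" "card Q \<le> p"
  shows "(\<integral>\<^sup>+y. (\<Prod>v\<in>insert t Q. f (y v)) * (\<integral>\<^sup>+z. f z * (\<Prod>v\<in>insert t Q. w z (y v)) \<partial>M) ^ p
            \<partial>PiM (insert t Q) (\<lambda>_. M))
       \<le> (\<integral>\<^sup>+y. (\<Prod>v\<in>Q. f (y v)) * (\<integral>\<^sup>+z. f z * (\<Prod>v\<in>Q. w z (y v)) \<partial>M) ^ Suc p \<partial>PiM Q (\<lambda>_. M))"
proof -
  interpret M: sigma_finite_measure M by fact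
  interpret P: product_sigma_finite "\<lambda>_. M" ..
  let ?q = "card Q"
  define m where "m = p - ?q"
  have p: "p = m + ?q" using Q by (simp add: m_def)
  let ?N = "PiM Q (\<lambda>_. M)"
  interpret N: sigma_finite_measure ?N using Q by (intro P.sigma_finite)
  interpret NN: pair_sigma_finite ?N ?N ..
  interpret NM: pair_sigma_finite ?N M ..
  \<comment> \<open>\<open>\<phi>\<close> is the vertex weight of a copy of \<open>Q\<close>;
    \<open>k z y\<close> joins \<open>z\<close> to all of \<open>y\<close>; \<open>h\<close> and
    \<open>g\<close> are weighted counts of common neighbours of \<open>y\<close>, and of
    \<open>y\<close> together with the moved vertex \<open>s\<close>; \<open>K\<close> joins two
    copies of \<open>Q\<close> completely.\<close>
  define \<phi> where "\<phi> y = (\<Prod>v\<in>Q. f (y v))" for y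
  define k where "k z y = (\<Prod>v\<in>Q. w z (y v))" for z y
  define h where "h y = (\<integral>\<^sup>+z. f z * k z y \<partial>M)" for y
  define g where "g y s = (\<integral>\<^sup>+z. f z * (w z s * k z y) \<partial>M)" for y s
  define K where "K x y = (\<Prod>u\<in>Q. k (x u) y)" for x y
  have w' [measurable]: "(\<lambda>x. w (a x) (b x)) \<in> borel_measurable L"
    if "a \<in> measurable L M" "b \<in> measurable L M" for a b and L :: "'z measure"
    using measurable_compose[OF measurable_Pair[OF that] w] by simp
  have \<phi> [measurable]: "\<phi> \<in> borel_measurable ?N"
    unfolding \<phi>_def by measurable
  have k [measurable]: "(\<lambda>(z, y). k z y) \<in> borel_measurable (M \<Otimes>\<^sub>M ?N)"
    unfolding k_def by measurable
  have k' [measurable]: "(\<lambda>x. k (a x) (b x)) \<in> borel_measurable L"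
    if "a \<in> measurable L M" "b \<in> measurable L ?N" for a b and L :: "'z measure"
    using measurable_compose[OF measurable_Pair[OF that] k] by simp
  have h [measurable]: "h \<in> borel_measurable ?N"
    unfolding h_def by measurable
  have g [measurable]: "(\<lambda>(y, s). g y s) \<in> borel_measurable (?N \<Otimes>\<^sub>M M)"
    unfolding g_def by measurable
  have K [measurable]: "(\<lambda>(x, y). K x y) \<in> borel_measurable (?N \<Otimes>\<^sub>M ?N)"
    unfolding K_def by measurable
  have K_sym: "K x y = K y x" for x y
    unfolding K_def k_def by (subst prod.swap) (simp add: sym)
  \<comment> \<open>The power of \<open>h y\<close> is read backwards as an integral over
    independent neighbours, that is, over a second copy \<open>x\<close> of \<open>Q\<close> joined
    to \<open>y\<close>.\<close>
  have hq: "(\<integral>\<^sup>+x. \<phi> x * K x y \<partial>?N) = h y ^ ?q" if "y \<in> space ?N" for y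
  proof -
    have "(\<integral>\<^sup>+x. \<phi> x * K x y \<partial>?N) = (\<integral>\<^sup>+x. (\<Prod>u\<in>Q. f (x u) * k (x u) y) \<partial>?N)"
      by (simp add: \<phi>_def K_def prod.distrib)
    also have "\<dots> = h y ^ ?q"
      using Q that by (subst P.product_nn_integral_prod) (auto simp: h_def)
    finally show ?thesis .
  qed
  \<comment> \<open>The same expansion makes \<open>x\<close> adjacent to \<open>y\<close> and to
    \<open>s\<close>. Integrating over \<open>s\<close> first then counts the common neighbours of
    \<open>x\<close>, which gives \<open>h x\<close>.\<close>
  have gq: "(\<integral>\<^sup>+s. f s * g y s ^ ?q \<partial>M) = (\<integral>\<^sup>+x. \<phi> x * K x y * h x \<partial>?N)" if y: "y \<in> space ?N" for y
  proof -
    have "g y s ^ ?q = (\<integral>\<^sup>+x. \<phi> x * K x y * k s x \<partial>?N)" if "s \<in> space M" for s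
    proof -
      have "g y s ^ ?q = (\<integral>\<^sup>+x. (\<Prod>u\<in>Q. f (x u) * (w (x u) s * k (x u) y)) \<partial>?N)"
        using Q y that by (subst P.product_nn_integral_prod) (auto simp: g_def)
      also have "\<dots> = (\<integral>\<^sup>+x. \<phi> x * K x y * k s x \<partial>?N)"
        by (simp add: \<phi>_def K_def k_def[of s] prod.distrib sym[of s] mult_ac)
      finally show ?thesis .
    qed
    then have "(\<integral>\<^sup>+s. f s * g y s ^ ?q \<partial>M) = (\<integral>\<^sup>+s. f s * (\<integral>\<^sup>+x. \<phi> x * K x y * k s x \<partial>?N) \<partial>M)"
      by (intro nn_integral_cong) simp
    also have "\<dots> = (\<integral>\<^sup>+s. \<integral>\<^sup>+x. f s * (\<phi> x * K x y * k s x) \<partial>?N \<partial>M)"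
      using y by (intro nn_integral_cong nn_integral_cmult[symmetric]) auto
    also have "\<dots> = (\<integral>\<^sup>+x. \<integral>\<^sup>+s. f s * (\<phi> x * K x y * k s x) \<partial>M \<partial>?N)"
      using y by (intro NM.Fubini') measurable
    also have "\<dots> = (\<integral>\<^sup>+x. \<integral>\<^sup>+s. \<phi> x * K x y * (f s * k s x) \<partial>M \<partial>?N)"
      by (simp add: mult_ac)
    also have "\<dots> = (\<integral>\<^sup>+x. \<phi> x * K x y * h x \<partial>?N)"
      unfolding h_def by (intro nn_integral_cong nn_integral_cmult) auto
    finally show ?thesis .
  qed
  have gh: "g y s \<le> h y" for y s
  proof -
    have "w z s * k z y \<le> k z y" for z
      using mult_right_mono[OF le_1, of "k z y"] by simp
    then show ?thesis
      unfolding g_def h_def by (intro nn_integral_mono mult_left_mono) auto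
  qed
  let ?L = "\<integral>\<^sup>+y. \<integral>\<^sup>+x. \<phi> y * \<phi> x * K x y * (h y ^ m * h x) \<partial>?N \<partial>?N"
  let ?R = "\<integral>\<^sup>+y. \<integral>\<^sup>+x. \<phi> y * \<phi> x * K x y * h y ^ Suc m \<partial>?N \<partial>?N"
  have "(\<integral>\<^sup>+y. (\<Prod>v\<in>insert t Q. f (y v)) * (\<integral>\<^sup>+z. f z * (\<Prod>v\<in>insert t Q. w z (y v)) \<partial>M) ^ p
            \<partial>PiM (insert t Q) (\<lambda>_. M)) =
        (\<integral>\<^sup>+y. \<integral>\<^sup>+s. (\<Prod>v\<in>insert t Q. f ((y(t := s)) v))
            * (\<integral>\<^sup>+z. f z * (\<Prod>v\<in>insert t Q. w z ((y(t := s)) v)) \<partial>M) ^ p \<partial>M \<partial>?N)"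
    using Q by (intro P.product_nn_integral_insert) measurable
  also have "\<dots> = (\<integral>\<^sup>+y. \<integral>\<^sup>+s. \<phi> y * (f s * g y s ^ p) \<partial>M \<partial>?N)"
  proof -
    have "(\<Prod>v\<in>insert t Q. F ((y(t := s)) v)) = F s * (\<Prod>v\<in>Q. F (y v))" for F :: "'a \<Rightarrow> ennreal" and y s
    proof -
      have "(\<Prod>v\<in>Q. F ((y(t := s)) v)) = (\<Prod>v\<in>Q. F (y v))"
        using Q by (intro prod.cong) auto
      then show ?thesis
        using Q by simp
    qed
    note * = this[of f] this[of "w _"]
    show ?thesis unfolding * by (simp add: \<phi>_def g_def k_def mult_ac)
  qed
  also have "\<dots> \<le> (\<integral>\<^sup>+y. \<integral>\<^sup>+s. \<phi> y * h y ^ m * (f s * g y s ^ ?q) \<partial>M \<partial>?N)"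
    \<comment> \<open>deletes the edges between the moved vertex and \<open>m\<close> of its neighbours\<close>
  proof (intro nn_integral_mono)
    fix y s
    have "\<phi> y * (f s * g y s ^ p) = \<phi> y * g y s ^ m * (f s * g y s ^ ?q)"
      by (simp add: p power_add mult_ac)
    also have "\<dots> \<le> \<phi> y * h y ^ m * (f s * g y s ^ ?q)"
      by (intro mult_left_mono mult_right_mono power_mono gh) auto
    finally show "\<phi> y * (f s * g y s ^ p) \<le> \<phi> y * h y ^ m * (f s * g y s ^ ?q)" .
  qed
  also have "\<dots> = (\<integral>\<^sup>+y. \<phi> y * h y ^ m * (\<integral>\<^sup>+s. f s * g y s ^ ?q \<partial>M) \<partial>?N)"
    by (intro nn_integral_cong nn_integral_cmult) auto
  also have "\<dots> = (\<integral>\<^sup>+y. \<phi> y * h y ^ m * (\<integral>\<^sup>+x. \<phi> x * K x y * h x \<partial>?N) \<partial>?N)"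
    by (intro nn_integral_cong) (simp add: gq)
  also have "\<dots> = (\<integral>\<^sup>+y. \<integral>\<^sup>+x. \<phi> y * h y ^ m * (\<phi> x * K x y * h x) \<partial>?N \<partial>?N)"
    by (intro nn_integral_cong nn_integral_cmult[symmetric]) auto
  also have "\<dots> = ?L" by (simp add: mult_ac)
  also have "?L \<le> ?R"
  proof -
    \<comment> \<open>\<open>\<phi> y * \<phi> x * K x y\<close> is invariant under exchanging
      \<open>x\<close> and \<open>y\<close>, so each integral equals the one with the roles of
      \<open>h x\<close> and \<open>h y\<close> exchanged. Adding both forms makes the pointwise
      inequality applicable.\<close>
    have L': "?L = (\<integral>\<^sup>+y. \<integral>\<^sup>+x. \<phi> y * \<phi> x * K x y * (h x ^ m * h y) \<partial>?N \<partial>?N)"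
      by (subst NN.Fubini', measurable) (simp add: K_sym mult.commute mult.left_commute)
    have R': "?R = (\<integral>\<^sup>+y. \<integral>\<^sup>+x. \<phi> y * \<phi> x * K x y * h x ^ Suc m \<partial>?N \<partial>?N)"
      by (subst NN.Fubini', measurable) (simp add: K_sym mult.commute mult.left_commute)
    have add: "(\<integral>\<^sup>+y. \<integral>\<^sup>+x. F y x \<partial>?N \<partial>?N) + (\<integral>\<^sup>+y. \<integral>\<^sup>+x. G y x \<partial>?N \<partial>?N)
        = (\<integral>\<^sup>+y. \<integral>\<^sup>+x. F y x + G y x \<partial>?N \<partial>?N)"
      if [measurable]: "(\<lambda>(y, x). F y x) \<in> borel_measurable (?N \<Otimes>\<^sub>M ?N)"
        "(\<lambda>(y, x). G y x) \<in> borel_measurable (?N \<Otimes>\<^sub>M ?N)" for F G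
      by (subst nn_integral_add[symmetric]) (auto intro!: nn_integral_cong nn_integral_add[symmetric])
    have "2 * ?L = ?L + (\<integral>\<^sup>+y. \<integral>\<^sup>+x. \<phi> y * \<phi> x * K x y * (h x ^ m * h y) \<partial>?N \<partial>?N)"
      using L' by (simp only: mult_2)
    also have "\<dots> = (\<integral>\<^sup>+y. \<integral>\<^sup>+x. \<phi> y * \<phi> x * K x y * (h y ^ m * h x + h x ^ m * h y) \<partial>?N \<partial>?N)"
      by (subst add) (measurable, simp only: distrib_left)
    also have "\<dots> \<le> (\<integral>\<^sup>+y. \<integral>\<^sup>+x. \<phi> y * \<phi> x * K x y * (h y ^ Suc m + h x ^ Suc m) \<partial>?N \<partial>?N)"
      by (intro nn_integral_mono mult_left_mono mixed_power_sum_le) auto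
    also have "\<dots> = ?R + (\<integral>\<^sup>+y. \<integral>\<^sup>+x. \<phi> y * \<phi> x * K x y * h x ^ Suc m \<partial>?N \<partial>?N)"
      by (subst add) (measurable, simp only: distrib_left)
    also have "\<dots> = 2 * ?R"
      using R' by (simp only: mult_2)
    \<comment> \<open>The factor 2 cancels even if the integrals are infinite, being neither 0 nor
      infinity.\<close>
    finally show ?thesis by (subst (asm) ennreal_mult_le_mult_iff) auto
  qed
  also have "?R = (\<integral>\<^sup>+y. \<integral>\<^sup>+x. \<phi> y * h y ^ Suc m * (\<phi> x * K x y) \<partial>?N \<partial>?N)"
    by (simp add: mult_ac)
  also have "\<dots> = (\<integral>\<^sup>+y. \<phi> y * h y ^ Suc m * (\<integral>\<^sup>+x. \<phi> x * K x y \<partial>?N) \<partial>?N)"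
    by (intro nn_integral_cong nn_integral_cmult) auto
  also have "\<dots> = (\<integral>\<^sup>+y. \<phi> y * h y ^ Suc p \<partial>?N)"
    by (intro nn_integral_cong) (simp add: hq p power_add mult_ac)
  finally show ?thesis by (simp only: \<phi>_def h_def k_def)
qed

section \<open>Integrating out two parts of a multipartite graph\<close>

text \<open>Tonelli in the order \<open>R\<close>, \<open>Q\<close>, \<open>P\<close>: there are no
  factors between two vertices of \<open>P\<close>, so with \<open>R\<close> and \<open>Q\<close>
  fixed the integral over \<open>P\<close> splits into equal factors. \<open>\<rho>\<close> stands
  for the edges inside \<open>R\<close>. The inner integral has the form treated by
  \<open>nn_integral_multipartite_shift\<close>.\<close>

lemma nn_integral_three_blocks:
  fixes M :: "'a measure" and w :: "'a \<Rightarrow> 'a \<Rightarrow> ennreal" and P Q R :: "'v set"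
  assumes "sigma_finite_measure M"
    and w [measurable]: "(\<lambda>(x, y). w x y) \<in> borel_measurable (M \<Otimes>\<^sub>M M)"
    and fin: "finite P" "finite Q" "finite R"
    and disj: "P \<inter> Q = {}" "R \<inter> (Q \<union> P) = {}"
    and \<rho>_meas: "\<rho> \<in> borel_measurable (PiM R (\<lambda>_. M))"
    and \<rho>_cong: "\<And>x y. (\<And>v. v \<in> R \<Longrightarrow> x v = y v) \<Longrightarrow> \<rho> x = \<rho> y"
  shows "(\<integral>\<^sup>+x. \<rho> x * (\<Prod>u\<in>Q \<union> P. \<Prod>r\<in>R. w (x u) (x r)) * (\<Prod>u\<in>P. \<Prod>v\<in>Q. w (x u) (x v))
            \<partial>PiM (R \<union> (Q \<union> P)) (\<lambda>_. M))
       = (\<integral>\<^sup>+r. \<rho> r * (\<integral>\<^sup>+y. (\<Prod>v\<in>Q. \<Prod>s\<in>R. w (y v) (r s))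
            * (\<integral>\<^sup>+z. (\<Prod>s\<in>R. w z (r s)) * (\<Prod>v\<in>Q. w z (y v)) \<partial>M) ^ card P \<partial>PiM Q (\<lambda>_. M))
            \<partial>PiM R (\<lambda>_. M))"
proof -
  interpret M: sigma_finite_measure M by fact
  interpret Pr: product_sigma_finite "\<lambda>_. M" ..
  have w' [measurable]: "(\<lambda>x. w (a x) (b x)) \<in> borel_measurable L"
    if "a \<in> measurable L M" "b \<in> measurable L M" for a b and L :: "'z measure"
    using measurable_compose[OF measurable_Pair[OF that] w] by simp
  have rest: "(\<lambda>x. restrict x R) \<in> measurable (PiM (R \<union> (Q \<union> P)) (\<lambda>_. M)) (PiM R (\<lambda>_. M))"
    by (intro measurable_restrict_subset) auto
  have "\<rho> (restrict x R) = \<rho> x" for x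
    by (intro \<rho>_cong) auto
  then have \<rho>_meas' [measurable]: "\<rho> \<in> borel_measurable (PiM (R \<union> (Q \<union> P)) (\<lambda>_. M))"
    using measurable_compose[OF rest \<rho>_meas] by simp
  have inner: "(\<integral>\<^sup>+x. \<rho> (merge R (Q \<union> P) (r, x))
          * (\<Prod>u\<in>Q \<union> P. \<Prod>s\<in>R. w (merge R (Q \<union> P) (r, x) u) (merge R (Q \<union> P) (r, x) s))
          * (\<Prod>u\<in>P. \<Prod>v\<in>Q. w (merge R (Q \<union> P) (r, x) u) (merge R (Q \<union> P) (r, x) v))
          \<partial>PiM (Q \<union> P) (\<lambda>_. M))
      = \<rho> r * (\<integral>\<^sup>+y. (\<Prod>v\<in>Q. \<Prod>s\<in>R. w (y v) (r s))
            * (\<integral>\<^sup>+z. (\<Prod>s\<in>R. w z (r s)) * (\<Prod>v\<in>Q. w z (y v)) \<partial>M) ^ card P \<partial>PiM Q (\<lambda>_. M))"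
    (is "?lhs = _") if r [measurable]: "r \<in> space (PiM R (\<lambda>_. M))" for r
  proof -
    define f where "f z = (\<Prod>s\<in>R. w z (r s))" for z
    have rM: "r s \<in> space M" if "s \<in> R" for s
      using r that by (auto simp: space_PiM)
    have f [measurable]: "f \<in> borel_measurable M"
      unfolding f_def using rM by measurable
    have "?lhs = (\<integral>\<^sup>+x. \<rho> r * ((\<Prod>u\<in>Q \<union> P. f (x u)) * (\<Prod>u\<in>P. \<Prod>v\<in>Q. w (x u) (x v)))
        \<partial>PiM (Q \<union> P) (\<lambda>_. M))"
    proof (intro nn_integral_cong)
      fix x
      have "\<rho> (merge R (Q \<union> P) (r, x)) = \<rho> r"
        by (intro \<rho>_cong) (auto simp: merge_def)
      moreover have "(\<Prod>u\<in>Q \<union> P. \<Prod>s\<in>R. w (merge R (Q \<union> P) (r, x) u) (merge R (Q \<union> P) (r, x) s))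
          = (\<Prod>u\<in>Q \<union> P. f (x u))"
        unfolding f_def using disj by (intro prod.cong refl) (auto simp: merge_def)
      moreover have "(\<Prod>u\<in>P. \<Prod>v\<in>Q. w (merge R (Q \<union> P) (r, x) u) (merge R (Q \<union> P) (r, x) v))
          = (\<Prod>u\<in>P. \<Prod>v\<in>Q. w (x u) (x v))"
        using disj by (intro prod.cong refl) (auto simp: merge_def)
      ultimately show "\<rho> (merge R (Q \<union> P) (r, x))
          * (\<Prod>u\<in>Q \<union> P. \<Prod>s\<in>R. w (merge R (Q \<union> P) (r, x) u) (merge R (Q \<union> P) (r, x) s))
          * (\<Prod>u\<in>P. \<Prod>v\<in>Q. w (merge R (Q \<union> P) (r, x) u) (merge R (Q \<union> P) (r, x) v))
        = \<rho> r * ((\<Prod>u\<in>Q \<union> P. f (x u)) * (\<Prod>u\<in>P. \<Prod>v\<in>Q. w (x u) (x v)))"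
        by (simp only: mult.assoc)
    qed
    also have "\<dots> = \<rho> r * (\<integral>\<^sup>+x. (\<Prod>u\<in>Q \<union> P. f (x u)) * (\<Prod>u\<in>P. \<Prod>v\<in>Q. w (x u) (x v))
        \<partial>PiM (Q \<union> P) (\<lambda>_. M))"
      by (intro nn_integral_cmult) measurable
    also have "(\<integral>\<^sup>+x. (\<Prod>u\<in>Q \<union> P. f (x u)) * (\<Prod>u\<in>P. \<Prod>v\<in>Q. w (x u) (x v))
        \<partial>PiM (Q \<union> P) (\<lambda>_. M))
      = (\<integral>\<^sup>+y. \<integral>\<^sup>+x. (\<Prod>u\<in>Q \<union> P. f (merge Q P (y, x) u))
          * (\<Prod>u\<in>P. \<Prod>v\<in>Q. w (merge Q P (y, x) u) (merge Q P (y, x) v))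
          \<partial>PiM P (\<lambda>_. M) \<partial>PiM Q (\<lambda>_. M))"
      using fin disj by (intro Pr.product_nn_integral_fold) (auto simp: Int_commute)
    also have "\<dots> = (\<integral>\<^sup>+y. (\<Prod>v\<in>Q. f (y v))
            * (\<integral>\<^sup>+z. f z * (\<Prod>v\<in>Q. w z (y v)) \<partial>M) ^ card P \<partial>PiM Q (\<lambda>_. M))"
    proof (intro nn_integral_cong)
      fix y assume y: "y \<in> space (PiM Q (\<lambda>_. M))"
      then have yM: "y v \<in> space M" if "v \<in> Q" for v
        using that by (auto simp: space_PiM)
      have meas [measurable]: "(\<lambda>z. f z * (\<Prod>v\<in>Q. w z (y v))) \<in> borel_measurable M"
        using yM by measurable
      have "(\<Prod>u\<in>Q \<union> P. f (merge Q P (y, x) u))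
          * (\<Prod>u\<in>P. \<Prod>v\<in>Q. w (merge Q P (y, x) u) (merge Q P (y, x) v))
        = (\<Prod>v\<in>Q. f (y v)) * (\<Prod>u\<in>P. f (x u) * (\<Prod>v\<in>Q. w (x u) (y v)))" for x
      proof -
        have "(\<Prod>u\<in>Q. f (merge Q P (y, x) u)) = (\<Prod>u\<in>Q. f (y u))"
          "(\<Prod>u\<in>P. f (merge Q P (y, x) u)) = (\<Prod>u\<in>P. f (x u))"
          "(\<Prod>u\<in>P. \<Prod>v\<in>Q. w (merge Q P (y, x) u) (merge Q P (y, x) v))
            = (\<Prod>u\<in>P. \<Prod>v\<in>Q. w (x u) (y v))"
          using disj by (auto simp: merge_def intro!: prod.cong)
        then show ?thesis
          using fin disj by (subst prod.union_disjoint) (auto simp: prod.distrib mult.assoc)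
      qed
      then have "(\<integral>\<^sup>+x. (\<Prod>u\<in>Q \<union> P. f (merge Q P (y, x) u))
          * (\<Prod>u\<in>P. \<Prod>v\<in>Q. w (merge Q P (y, x) u) (merge Q P (y, x) v)) \<partial>PiM P (\<lambda>_. M))
        = (\<integral>\<^sup>+x. (\<Prod>v\<in>Q. f (y v)) * (\<Prod>u\<in>P. f (x u) * (\<Prod>v\<in>Q. w (x u) (y v))) \<partial>PiM P (\<lambda>_. M))"
        by (simp only:)
      also have "\<dots> = (\<Prod>v\<in>Q. f (y v)) * (\<integral>\<^sup>+x. (\<Prod>u\<in>P. f (x u) * (\<Prod>v\<in>Q. w (x u) (y v))) \<partial>PiM P (\<lambda>_. M))"
        using yM by (intro nn_integral_cmult) measurable
      also have "(\<integral>\<^sup>+x. (\<Prod>u\<in>P. f (x u) * (\<Prod>v\<in>Q. w (x u) (y v))) \<partial>PiM P (\<lambda>_. M))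
          = (\<integral>\<^sup>+z. f z * (\<Prod>v\<in>Q. w z (y v)) \<partial>M) ^ card P"
        using fin by (subst Pr.product_nn_integral_prod) auto
      finally show "(\<integral>\<^sup>+x. (\<Prod>u\<in>Q \<union> P. f (merge Q P (y, x) u))
          * (\<Prod>u\<in>P. \<Prod>v\<in>Q. w (merge Q P (y, x) u) (merge Q P (y, x) v)) \<partial>PiM P (\<lambda>_. M))
        = (\<Prod>v\<in>Q. f (y v)) * (\<integral>\<^sup>+z. f z * (\<Prod>v\<in>Q. w z (y v)) \<partial>M) ^ card P" .
    qed
    finally show ?thesis by (simp only: f_def)
  qed
  show ?thesis
  proof (subst Pr.product_nn_integral_fold[OF disj(2) fin(3)])
    show "finite (Q \<union> P)" using fin by simp
  qed (measurable, intro nn_integral_cong inner)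
qed

section \<open>Edge products and a single transfer between parts\<close>

text \<open>The integrand of \<open>hom_density\<close> with values in \<open>ennreal\<close>, so
  that the integration order may be changed freely.\<close>

definition edge_product :: "('a \<Rightarrow> 'a \<Rightarrow> real) \<Rightarrow> 'v set set \<Rightarrow> ('v \<Rightarrow> 'a) \<Rightarrow> ennreal" where
  "edge_product w E x = (\<Prod>e\<in>E. ennreal (edge_value (\<lambda>u v. w (x u) (x v)) e))"

lemma edge_product_measurable:
  assumes w: "(\<lambda>(x, y). w x y) \<in> borel_measurable (M \<Otimes>\<^sub>M M)" and sym: "\<And>x y. w x y = w y x"
    and E: "\<forall>e\<in>E. e \<subseteq> V \<and> card e = 2"
  shows "edge_product w E \<in> borel_measurable (PiM V (\<lambda>_. M))"
  unfolding edge_product_def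
proof (rule borel_measurable_prod_ennreal)
  fix e assume "e \<in> E"
  then obtain u v where e: "e = {u, v}" "u \<in> V" "v \<in> V"
    using E by (auto simp: card_2_iff)
  have "(\<lambda>x. w (x u) (x v)) \<in> borel_measurable (PiM V (\<lambda>_. M))"
    using measurable_compose[OF measurable_Pair[OF measurable_component_singleton[OF e(2)]
      measurable_component_singleton[OF e(3)]] w] by simp
  then show "(\<lambda>x. ennreal (edge_value (\<lambda>u v. w (x u) (x v)) e)) \<in> borel_measurable (PiM V (\<lambda>_. M))"
    unfolding e(1) by (subst edge_value_insert) (auto simp: sym)
qed

lemma edge_product_cong:
  assumes sym: "\<And>x y. w x y = w y x" and E: "\<forall>e\<in>E. e \<subseteq> V \<and> card e = 2"
    and "\<And>v. v \<in> V \<Longrightarrow> x v = y v"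
  shows "edge_product w E x = edge_product w E y"
  unfolding edge_product_def
proof (rule prod.cong)
  fix e assume "e \<in> E"
  then obtain u v where e: "e = {u, v}" "u \<in> V" "v \<in> V"
    using E by (auto simp: card_2_iff)
  show "ennreal (edge_value (\<lambda>u v. w (x u) (x v)) e) = ennreal (edge_value (\<lambda>u v. w (y u) (y v)) e)"
    unfolding e(1) using assms(3) e by (simp add: edge_value_insert sym)
qed simp

text \<open>Since \<open>A\<close> and \<open>B\<close> are disjoint, distinct pairs give distinct
  edges, and the product over edges can be reindexed by pairs.\<close>

lemma edge_product_bipartite:
  assumes sym: "\<And>x y. w x y = w y x" and "A \<inter> B = {}"
  shows "edge_product w ((\<lambda>(u, v). {u, v}) ` (A \<times> B)) x = (\<Prod>u\<in>A. \<Prod>v\<in>B. ennreal (w (x u) (x v)))"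
proof -
  have inj: "inj_on (\<lambda>(u, v). {u, v}) (A \<times> B)"
    using assms(2) by (auto simp: inj_on_def doubleton_eq_iff)
  show ?thesis
    unfolding edge_product_def
    by (subst prod.reindex[OF inj])
      (auto simp: prod.cartesian_product edge_value_insert sym intro!: prod.cong)
qed

lemma edge_product_union:
  assumes "finite E" "finite F" "E \<inter> F = {}"
  shows "edge_product w (E \<union> F) x = edge_product w E x * edge_product w F x"
  using assms by (simp add: edge_product_def prod.union_disjoint)

text \<open>Both densities are integrals over the same remaining parts \<open>R\<close>. For each
  fixed placement of \<open>R\<close> the two inner integrals are compared by
  \<open>nn_integral_multipartite_shift\<close>, with \<open>R\<close> supplying the vertex
  weight.\<close>

lemma nn_integral_complete_multipartite_transfer:
  fixes M :: "'a measure" and w :: "'a \<Rightarrow> 'a \<Rightarrow> real"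
  assumes sf: "sigma_finite_measure M"
    and w: "(\<lambda>(x, y). w x y) \<in> borel_measurable (M \<Otimes>\<^sub>M M)"
    and sym: "\<And>x y. w x y = w y x" and le_1: "\<And>x y. w x y \<le> 1"
    and ij: "i < length a" "j < length a" "i \<noteq> j" "a ! j < a ! i"
  defines "b \<equiv> a[i := a ! i - 1, j := Suc (a ! j)]"
  shows "(\<integral>\<^sup>+x. edge_product w (snd (complete_multipartite b)) x
            \<partial>PiM (fst (complete_multipartite b)) (\<lambda>_. M))
       \<le> (\<integral>\<^sup>+x. edge_product w (snd (complete_multipartite a)) x
            \<partial>PiM (fst (complete_multipartite a)) (\<lambda>_. M))"
proof -
  define R where "R = {(s, l). s < length a \<and> s \<noteq> i \<and> s \<noteq> j \<and> l < a ! s}"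
  define E where "E = {{u, v} | u v. u \<in> R \<and> v \<in> R \<and> fst u \<noteq> fst v}"
  define \<rho> where "\<rho> = edge_product w E"
  have "R = (SIGMA s:{..<length a} - {i, j}. {..<a ! s})"
    by (auto simp: R_def)
  then have finR: "finite R" by simp
  have E2: "\<forall>e\<in>E. e \<subseteq> R \<and> card e = 2"
    by (auto simp: E_def card_2_iff)
  have "E \<subseteq> Pow R" using E2 by auto
  then have finE: "finite E" using finR by (auto intro: finite_subset)
  have w' [measurable]: "(\<lambda>(x, y). ennreal (w x y)) \<in> borel_measurable (M \<Otimes>\<^sub>M M)"
    using measurable_compose[OF w measurable_ennreal] by (simp add: case_prod_unfold)
  have w'' [measurable]: "(\<lambda>x. ennreal (w (g x) (h x))) \<in> borel_measurable L"
    if "g \<in> measurable L M" "h \<in> measurable L M" for g h and L :: "'z measure"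
    using measurable_compose[OF measurable_Pair[OF that] w'] by simp
  have \<rho>: "\<rho> \<in> borel_measurable (PiM R (\<lambda>_. M))"
    unfolding \<rho>_def by (rule edge_product_measurable[OF w sym E2])
  have \<rho>_cong: "\<rho> x = \<rho> y" if "\<And>v. v \<in> R \<Longrightarrow> x v = y v" for x y
    unfolding \<rho>_def by (rule edge_product_cong[OF sym E2 that])
  \<comment> \<open>Stated for any \<open>c\<close> that agrees with \<open>a\<close> outside
    \<open>i\<close> and \<open>j\<close>, so that it applies both before and after the transfer
    with the same \<open>R\<close> and \<open>\<rho>\<close>.\<close>
  have block: "(\<integral>\<^sup>+x. edge_product w (snd (complete_multipartite c)) x
            \<partial>PiM (fst (complete_multipartite c)) (\<lambda>_. M))
       = (\<integral>\<^sup>+r. \<rho> r * (\<integral>\<^sup>+y. (\<Prod>v\<in>{j} \<times> {..<c ! j}. \<Prod>s\<in>R. ennreal (w (y v) (r s)))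
            * (\<integral>\<^sup>+z. (\<Prod>s\<in>R. ennreal (w z (r s))) * (\<Prod>v\<in>{j} \<times> {..<c ! j}. ennreal (w z (y v))) \<partial>M) ^ (c ! i)
              \<partial>PiM ({j} \<times> {..<c ! j}) (\<lambda>_. M)) \<partial>PiM R (\<lambda>_. M))"
    if len: "length c = length a" and eq: "\<And>s. s < length a \<Longrightarrow> s \<noteq> i \<Longrightarrow> s \<noteq> j \<Longrightarrow> c ! s = a ! s" for c
  proof -
    define P where "P = {i} \<times> {..<c ! i}"
    define Q where "Q = {j} \<times> {..<c ! j}"
    have fin: "finite P" "finite Q" by (auto simp: P_def Q_def)
    have disj: "P \<inter> Q = {}" "R \<inter> (Q \<union> P) = {}"
      using ij by (auto simp: P_def Q_def R_def)
    have V: "fst (complete_multipartite c) = R \<union> (Q \<union> P)"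
    proof -
      have "R = {(s, l). s < length c \<and> s \<noteq> i \<and> s \<noteq> j \<and> l < c ! s}"
        using len eq by (auto simp: R_def)
      then show ?thesis
        using len ij by (auto simp: complete_multipartite_def Let_def P_def Q_def)
    qed
    have snd: "snd (complete_multipartite c) = {{u, v} | u v. u \<in> R \<union> (Q \<union> P) \<and> v \<in> R \<union> (Q \<union> P) \<and> fst u \<noteq> fst v}"
      using V by (simp add: complete_multipartite_def Let_def)
    have colours: "\<And>u. u \<in> P \<Longrightarrow> fst u = i" "\<And>u. u \<in> Q \<Longrightarrow> fst u = j" "\<And>u. u \<in> R \<Longrightarrow> fst u \<noteq> i \<and> fst u \<noteq> j"
      by (auto simp: P_def Q_def R_def)
    let ?B = "\<lambda>A B. (\<lambda>(u, v). {u, v}) ` (A \<times> B)"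
    have dec: "snd (complete_multipartite c) = E \<union> ?B (Q \<union> P) R \<union> ?B P Q"
    proof (rule set_eqI)
      fix e
      have "e \<in> snd (complete_multipartite c) \<longleftrightarrow>
        (\<exists>u v. e = {u, v} \<and> u \<in> R \<and> v \<in> R \<and> fst u \<noteq> fst v) \<or> (\<exists>u\<in>Q \<union> P. \<exists>v\<in>R. e = {u, v}) \<or> (\<exists>u\<in>P. \<exists>v\<in>Q. e = {u, v})"
        (is "_ \<longleftrightarrow> ?X")
      proof
        assume "e \<in> snd (complete_multipartite c)"
        then obtain u v where uv: "e = {u, v}" "u \<in> R \<union> (Q \<union> P)" "v \<in> R \<union> (Q \<union> P)" "fst u \<noteq> fst v"
          unfolding snd by blast
        have e': "e = {v, u}" using uv by auto
        consider "u \<in> R" "v \<in> R" | "u \<in> R" "v \<in> Q \<union> P" | "u \<in> Q \<union> P" "v \<in> R"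
          | "u \<in> P" "v \<in> Q" | "u \<in> Q" "v \<in> P"
        proof -
          have "\<not> (u \<in> P \<and> v \<in> P)" "\<not> (u \<in> Q \<and> v \<in> Q)"
            using uv(4) colours by metis+
          then show thesis
            using that uv(2,3) by blast
        qed
        then show ?X using uv e' by cases blast+
      next
        assume ?X
        then show "e \<in> snd (complete_multipartite c)"
          unfolding snd using colours \<open>i \<noteq> j\<close> by auto blast+
      qed
      then show "e \<in> snd (complete_multipartite c) \<longleftrightarrow> e \<in> E \<union> ?B (Q \<union> P) R \<union> ?B P Q"
        unfolding E_def by auto
    qed
    \<comment> \<open>The three families of edges are told apart by their intersection with
      \<open>R\<close>: contained in \<open>R\<close>, meeting \<open>R\<close> without being
      contained, disjoint from \<open>R\<close>.\<close>
    have sE: "e \<subseteq> R \<and> e \<noteq> {}" if "e \<in> E" for e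
      using E2 that by fastforce
    have sR: "\<not> e \<subseteq> R \<and> e \<inter> R \<noteq> {}" if e: "e \<in> ?B (Q \<union> P) R" for e
    proof -
      obtain u v where "e = {u, v}" "u \<in> Q \<union> P" "v \<in> R"
        using e by auto
      then show ?thesis using disj(2) by auto
    qed
    have sPQ: "e \<inter> R = {}" if e: "e \<in> ?B P Q" for e
    proof -
      obtain u v where "e = {u, v}" "u \<in> P" "v \<in> Q"
        using e by auto
      then show ?thesis using disj(2) by auto
    qed
    have d1: "E \<inter> ?B (Q \<union> P) R = {}"
      using sE sR by (meson disjoint_iff)
    have d2: "(E \<union> ?B (Q \<union> P) R) \<inter> ?B P Q = {}"
    proof (rule ccontr)
      assume "\<not> ?thesis"
      then obtain e where e: "e \<in> E \<or> e \<in> ?B (Q \<union> P) R" "e \<in> ?B P Q"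
        by (meson Int_emptyI UnE)
      from e(1) have "e \<inter> R \<noteq> {}"
      proof
        assume "e \<in> E"
        then show ?thesis using sE[of e] by (simp add: Int_absorb2)
      qed (use sR in simp)
      then show False using sPQ[OF e(2)] by simp
    qed
    have prod: "edge_product w (snd (complete_multipartite c)) x
       = \<rho> x * (\<Prod>u\<in>Q \<union> P. \<Prod>r\<in>R. ennreal (w (x u) (x r))) * (\<Prod>u\<in>P. \<Prod>v\<in>Q. ennreal (w (x u) (x v)))" for x
      unfolding dec using fin finR finE d1 d2 disj
      by (simp add: edge_product_union edge_product_bipartite[OF sym] Int_commute \<rho>_def)
    have "card P = c ! i" by (simp add: P_def)
    then show ?thesis
      unfolding prod V Q_def[symmetric]
      using nn_integral_three_blocks[OF sf w' fin finR disj \<rho> \<rho>_cong] by simp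
  qed
  obtain p where p: "a ! i = Suc p" using ij by (cases "a ! i") auto
  have b: "b ! i = p" "b ! j = Suc (a ! j)" "length b = length a"
    using ij p by (auto simp: b_def)
  \<comment> \<open>The moved vertex takes the first free label \<open>(j, a ! j)\<close> of part
    \<open>j\<close>. The hypothesis \<open>a ! j < a ! i\<close> becomes
    \<open>a ! j \<le> p\<close>.\<close>
  have ins: "{j} \<times> {..<b ! j} = insert (j, a ! j) ({j} \<times> {..<a ! j})"
    using b by auto
  have "\<rho> r * (\<integral>\<^sup>+y. (\<Prod>v\<in>{j} \<times> {..<b ! j}. \<Prod>s\<in>R. ennreal (w (y v) (r s)))
            * (\<integral>\<^sup>+z. (\<Prod>s\<in>R. ennreal (w z (r s))) * (\<Prod>v\<in>{j} \<times> {..<b ! j}. ennreal (w z (y v))) \<partial>M) ^ (b ! i)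
              \<partial>PiM ({j} \<times> {..<b ! j}) (\<lambda>_. M))
      \<le> \<rho> r * (\<integral>\<^sup>+y. (\<Prod>v\<in>{j} \<times> {..<a ! j}. \<Prod>s\<in>R. ennreal (w (y v) (r s)))
            * (\<integral>\<^sup>+z. (\<Prod>s\<in>R. ennreal (w z (r s))) * (\<Prod>v\<in>{j} \<times> {..<a ! j}. ennreal (w z (y v))) \<partial>M) ^ (a ! i)
              \<partial>PiM ({j} \<times> {..<a ! j}) (\<lambda>_. M))"
    if r: "r \<in> space (PiM R (\<lambda>_. M))" for r
  proof -
    have rM: "r s \<in> space M" if "s \<in> R" for s
      using r that by (auto simp: space_PiM)
    have f: "(\<lambda>z. \<Prod>s\<in>R. ennreal (w z (r s))) \<in> borel_measurable M"
      using rM by measurable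
    show ?thesis
      unfolding ins b(1) p
      by (intro mult_left_mono nn_integral_multipartite_shift[OF sf f w'])
        (use ij p le_1 in \<open>auto simp: sym\<close>)
  qed
  then show ?thesis
    using b by (subst (1 2) block) (auto simp: b_def intro!: nn_integral_mono)
qed

section \<open>Reaching a majorized sequence by unit transfers\<close>

text \<open>Only \<open>b\<close> has to be sorted: the partial sums of \<open>a\<close> dominate those of \<open>b\<close> throughout, so the
  intermediate sequences need not be reordered.\<close>

lemma majorizes_transfer_induct:
  fixes F :: "nat list \<Rightarrow> 'b::preorder"
  assumes step: "\<And>c i j. i < length c \<Longrightarrow> j < length c \<Longrightarrow> i \<noteq> j \<Longrightarrow> c ! j < c ! i
      \<Longrightarrow> F (c[i := c ! i - 1, j := Suc (c ! j)]) \<le> F c"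
    and b: "sorted_wrt (\<ge>) b"
    and len: "length a = length b"
    and prefix: "\<And>m. m \<le> length b \<Longrightarrow> (\<Sum>l<m. b ! l) \<le> (\<Sum>l<m. a ! l)"
    and total: "(\<Sum>l<length b. a ! l) = (\<Sum>l<length b. b ! l)"
  shows "F b \<le> F a"
  using len prefix total
\<comment> \<open>Truncated subtraction makes the measure the total excess of \<open>a\<close> over
  \<open>b\<close>, counting only positions where \<open>a\<close> is larger.\<close>
proof (induction "\<Sum>l<length b. a ! l - b ! l" arbitrary: a rule: less_induct)
  case less
  note len = less.prems(1) and prefix = less.prems(2) and total = less.prems(3)
  show ?case
  proof (cases "a = b")
    case False
    then have ex: "\<exists>l. l < length b \<and> a ! l \<noteq> b ! l"
      using len by (auto simp: list_eq_iff_nth_eq)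
    \<comment> \<open>At the first position where the sequences differ, the prefix condition forces
      \<open>a\<close> to be the larger one.\<close>
    define i where "i = (LEAST l. l < length b \<and> a ! l \<noteq> b ! l)"
    have i: "i < length b" "a ! i \<noteq> b ! i"
      using LeastI_ex[OF ex] unfolding i_def by auto
    have below_i: "a ! l = b ! l" if "l < i" for l
      using not_less_Least[of l "\<lambda>l. l < length b \<and> a ! l \<noteq> b ! l"] that i unfolding i_def by auto
    have "(\<Sum>l<Suc i. b ! l) \<le> (\<Sum>l<Suc i. a ! l)"
      using i by (intro prefix) auto
    moreover have "(\<Sum>l<i. b ! l) = (\<Sum>l<i. a ! l)"
      using below_i by (intro sum.cong) auto
    ultimately have gt_i: "b ! i < a ! i"
      using i by simp
    have ex': "\<exists>l. l < length b \<and> a ! l < b ! l"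
    proof (rule ccontr)
      assume "\<not> ?thesis"
      then have "b ! l \<le> a ! l" if "l < length b" for l
        using that by (meson not_less)
      then have "(\<Sum>l<length b. b ! l) < (\<Sum>l<length b. a ! l)"
        using gt_i i by (intro sum_strict_mono_ex1) auto
      then show False using total by simp
    qed
    \<comment> \<open>The first deficit; it exists because the surplus at \<open>i\<close> must be
      compensated in the equal totals.\<close>
    define j where "j = (LEAST l. l < length b \<and> a ! l < b ! l)"
    have j: "j < length b" "a ! j < b ! j"
      using LeastI_ex[OF ex'] unfolding j_def by auto
    have below_j: "b ! l \<le> a ! l" if "l < j" for l
      using not_less_Least[of l "\<lambda>l. l < length b \<and> a ! l < b ! l"] that j unfolding j_def by auto
    have "i < j"
      using below_i[of j] j gt_i by (cases i j rule: linorder_cases) auto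
    \<comment> \<open>Sortedness of \<open>b\<close> gives the chain
      \<open>a ! j < b ! j \<le> b ! i < a ! i\<close>, so the transfer from \<open>i\<close> to
      \<open>j\<close> is admissible.\<close>
    then have "b ! j \<le> b ! i"
      using b j by (auto simp: sorted_wrt_iff_nth_less)
    then have ji: "a ! j < a ! i"
      using gt_i j by simp
    define c where "c = a[i := a ! i - 1, j := Suc (a ! j)]"
    have c_i: "c ! i = a ! i - 1" and c_j: "c ! j = Suc (a ! j)"
      and c_other: "\<And>l. l \<noteq> i \<Longrightarrow> l \<noteq> j \<Longrightarrow> c ! l = a ! l"
      using \<open>i < j\<close> i j len by (auto simp: c_def)
    have sum_c: "(\<Sum>l<m. c ! l) = (\<Sum>l<m. a ! l)" if "j < m" for m
    proof -
      have "{..<m} = insert i (insert j ({..<m} - {i, j}))"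
        using that \<open>i < j\<close> by auto
      then have split: "(\<Sum>l<m. f l) = f i + (f j + (\<Sum>l\<in>{..<m} - {i, j}. f l))" for f :: "nat \<Rightarrow> nat"
        using \<open>i < j\<close> by (metis Diff_iff finite_Diff finite_insert finite_lessThan insertCI insertE nat_neq_iff sum.insert)
      have "(\<Sum>l\<in>{..<m} - {i, j}. c ! l) = (\<Sum>l\<in>{..<m} - {i, j}. a ! l)"
        by (intro sum.cong) (auto simp: c_other)
      then show ?thesis
        using gt_i by (simp add: split c_i c_j)
    qed
    \<comment> \<open>Prefixes containing \<open>j\<close> keep their sum. In shorter ones
      \<open>c\<close> dominates \<open>b\<close> termwise: there is no deficit before
      \<open>j\<close>, and the surplus at \<open>i\<close> was at least 1.\<close>
    have "(\<Sum>l<m. b ! l) \<le> (\<Sum>l<m. c ! l)" if "m \<le> length b" for m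
    proof (cases "j < m")
      case True
      then show ?thesis using prefix[OF that] sum_c by simp
    next
      case False
      have "b ! l \<le> c ! l" if "l < m" for l
        using that False below_j[of l] gt_i c_other[of l] c_i by (cases "l = i") auto
      then show ?thesis by (intro sum_mono) auto
    qed
    \<comment> \<open>The excess drops at \<open>i\<close>; at \<open>j\<close> it stays 0 since
      \<open>Suc (a ! j) \<le> b ! j\<close>.\<close>
    moreover have "(\<Sum>l<length b. c ! l - b ! l) < (\<Sum>l<length b. a ! l - b ! l)"
    proof (rule sum_strict_mono_ex1)
      show "\<forall>l\<in>{..<length b}. c ! l - b ! l \<le> a ! l - b ! l"
      proof
        fix l show "c ! l - b ! l \<le> a ! l - b ! l"
          using c_i c_j c_other[of l] j by (cases "l = i"; cases "l = j") auto
      qed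
      show "\<exists>l\<in>{..<length b}. c ! l - b ! l < a ! l - b ! l"
        using i gt_i c_i by (intro bexI[of _ i]) auto
    qed simp
    ultimately have "F b \<le> F c"
      using less.hyps[of c] len total sum_c[OF j(1)] by (simp add: c_def)
    also have "F c \<le> F a"
      unfolding c_def using i j len \<open>i < j\<close> ji by (intro step) auto
    finally show ?thesis .
  qed simp
qed

section \<open>Homomorphism densities as nonnegative integrals\<close>

text \<open>A graphon is symmetric and bounded only on the unit square; its extension by zero is so
  everywhere.\<close>

definition zero_extension :: "(real \<Rightarrow> real \<Rightarrow> real) \<Rightarrow> real \<Rightarrow> real \<Rightarrow> real" where
  "zero_extension W x y = (if x \<in> {0..1} \<and> y \<in> {0..1} then W x y else 0)"

lemma space_unit_measure: "space unit_measure = {0..1}"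
  by (simp add: space_restrict_space)

lemma emeasure_space_unit_measure: "emeasure unit_measure {0..1} = 1"
  by (simp add: emeasure_restrict_space)

lemma sigma_finite_unit_measure: "sigma_finite_measure unit_measure"
  by (intro finite_measure.axioms finite_measureI)
    (simp add: space_unit_measure emeasure_space_unit_measure)

context
  fixes W assumes W: "graphon W"
begin

lemma zero_extension_measurable:
  "(\<lambda>(x, y). zero_extension W x y) \<in> borel_measurable (unit_measure \<Otimes>\<^sub>M unit_measure)"
proof -
  have "(\<lambda>(x, y). W x y) \<in> borel_measurable (unit_measure \<Otimes>\<^sub>M unit_measure)"
    using W by (simp add: graphon_def)
  then show ?thesis
    by (rule measurable_cong[THEN iffD1, rotated])
      (auto simp: zero_extension_def space_pair_measure space_unit_measure)
qed

lemma zero_extension_sym: "zero_extension W x y = zero_extension W y x"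
  and zero_extension_nonneg: "0 \<le> zero_extension W x y"
  and zero_extension_le_1: "zero_extension W x y \<le> 1"
  using W by (auto simp: graphon_def zero_extension_def)

lemma edge_product_zero_extension_le_1:
  assumes "\<forall>e\<in>E. e \<subseteq> V \<and> card e = 2"
  shows "edge_product (zero_extension W) E x \<le> 1"
  unfolding edge_product_def
proof (intro prod_le_1 conjI)
  fix e assume "e \<in> E"
  then obtain u v where "e = {u, v}"
    using assms by (auto simp: card_2_iff)
  then show "ennreal (edge_value (\<lambda>u v. zero_extension W (x u) (x v)) e) \<le> 1"
    by (simp add: edge_value_insert zero_extension_sym zero_extension_le_1)
qed simp

context
  fixes G :: "'v graph" assumes G: "finite_simple_graph G"
begin

lemma nn_integral_edge_product_le_1:
  "(\<integral>\<^sup>+x. edge_product (zero_extension W) (snd G) x \<partial>PiM (fst G) (\<lambda>_. unit_measure)) \<le> 1"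
proof -
  interpret sigma_finite_measure unit_measure by (rule sigma_finite_unit_measure)
  interpret product_sigma_finite "\<lambda>_. unit_measure" ..
  have "(\<integral>\<^sup>+x. edge_product (zero_extension W) (snd G) x \<partial>PiM (fst G) (\<lambda>_. unit_measure))
      \<le> (\<integral>\<^sup>+x. (\<Prod>v\<in>fst G. 1) \<partial>PiM (fst G) (\<lambda>_. unit_measure))"
    using G by (intro nn_integral_mono) (auto simp: finite_simple_graph_def intro!: edge_product_zero_extension_le_1)
  also have "\<dots> = 1"
    using G by (subst product_nn_integral_prod)
      (auto simp: finite_simple_graph_def space_unit_measure emeasure_space_unit_measure)
  finally show ?thesis .
qed

text \<open>Transfers the Bochner integral to a nonnegative one. On the domain all coordinates lie
  in the unit interval, where the graphon and its zero extension coincide.\<close>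

lemma hom_density_eq_nn_integral:
  "hom_density G W =
     enn2real (\<integral>\<^sup>+x. edge_product (zero_extension W) (snd G) x \<partial>PiM (fst G) (\<lambda>_. unit_measure))"
proof -
  have edges: "\<forall>e\<in>snd G. e \<subseteq> fst G \<and> card e = 2"
    using G by (auto simp: finite_simple_graph_def)
  let ?N = "PiM (fst G) (\<lambda>_. unit_measure)"
  let ?g = "edge_product (zero_extension W) (snd G)"
  have eq: "(\<Prod>e\<in>snd G. edge_value (\<lambda>u v. W (x u) (x v)) e) = enn2real (?g x)"
    if x: "x \<in> space ?N" for x
  proof -
    have x: "x v \<in> {0..1}" if "v \<in> fst G" for v
      using x that by (auto simp: space_PiM space_unit_measure)
    have ev: "edge_value (\<lambda>u v. W (x u) (x v)) e = edge_value (\<lambda>u v. zero_extension W (x u) (x v)) e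
        \<and> 0 \<le> edge_value (\<lambda>u v. zero_extension W (x u) (x v)) e" if e: "e \<in> snd G" for e
    proof -
      obtain u v where uv: "e = {u, v}" "u \<in> fst G" "v \<in> fst G"
        using edges e by (auto simp: card_2_iff)
      have "W (x u) (x v) = W (x v) (x u)"
        using W uv x by (simp add: graphon_def)
      moreover have "W (x u) (x v) = zero_extension W (x u) (x v)"
        using uv x by (simp add: zero_extension_def)
      ultimately show ?thesis
        using zero_extension_nonneg[of "x u" "x v"] by (simp add: uv edge_value_insert zero_extension_sym)
    qed
    then have "?g x = ennreal (\<Prod>e\<in>snd G. edge_value (\<lambda>u v. W (x u) (x v)) e)"
      unfolding edge_product_def by (subst prod_ennreal[symmetric]) (auto intro!: prod.cong)
    moreover have "0 \<le> (\<Prod>e\<in>snd G. edge_value (\<lambda>u v. W (x u) (x v)) e)"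
      using ev by (intro prod_nonneg) auto
    ultimately show ?thesis by simp
  qed
  have meas: "?g \<in> borel_measurable ?N"
    by (rule edge_product_measurable[OF zero_extension_measurable zero_extension_sym edges])
  have "hom_density G W = (\<integral>x. enn2real (?g x) \<partial>?N)"
    unfolding hom_density_def using eq by (intro Bochner_Integration.integral_cong) auto
  also have "\<dots> = enn2real (\<integral>\<^sup>+x. ennreal (enn2real (?g x)) \<partial>?N)"
    using meas by (intro integral_eq_nn_integral) auto
  \<comment> \<open>The integrand is at most 1, hence finite, so passing through the reals loses
    nothing.\<close>
  also have "(\<integral>\<^sup>+x. ennreal (enn2real (?g x)) \<partial>?N) = (\<integral>\<^sup>+x. ?g x \<partial>?N)"
    using order.strict_trans1[OF edge_product_zero_extension_le_1[OF edges] ennreal_one_less_top]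
    by (intro nn_integral_cong ennreal_enn2real) auto
  finally show ?thesis .
qed

lemma hom_density_nonneg: "0 \<le> hom_density G W"
  by (simp add: hom_density_eq_nn_integral)

lemma ennreal_hom_density:
  "ennreal (hom_density G W) =
     (\<integral>\<^sup>+x. edge_product (zero_extension W) (snd G) x \<partial>PiM (fst G) (\<lambda>_. unit_measure))"
  unfolding hom_density_eq_nn_integral
  using nn_integral_edge_product_le_1 by (intro ennreal_enn2real) (auto simp: less_top[symmetric] top_unique)

lemma hom_density_le_1: "hom_density G W \<le> 1"
  using nn_integral_edge_product_le_1 by (simp flip: ennreal_hom_density)

end

section \<open>Monotonicity of the density under majorization\<close>

lemma hom_density_complete_multipartite_mono:
  assumes "majorizes a b" "sorted_wrt (\<ge>) b"
  shows "hom_density (complete_multipartite b) W \<le> hom_density (complete_multipartite a) W"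
proof (rule majorizes_transfer_induct[where F="\<lambda>c. hom_density (complete_multipartite c) W"])
  fix c :: "nat list" and i j
  assume "i < length c" "j < length c" "i \<noteq> j" "c ! j < c ! i"
  then have "ennreal (hom_density (complete_multipartite (c[i := c ! i - 1, j := Suc (c ! j)])) W)
      \<le> ennreal (hom_density (complete_multipartite c) W)"
    unfolding ennreal_hom_density[OF finite_simple_graph_complete_multipartite]
    by (intro nn_integral_complete_multipartite_transfer sigma_finite_unit_measure
      zero_extension_measurable zero_extension_sym zero_extension_le_1)
  then show "hom_density (complete_multipartite (c[i := c ! i - 1, j := Suc (c ! j)])) W
      \<le> hom_density (complete_multipartite c) W"
    by (simp add: hom_density_nonneg finite_simple_graph_complete_multipartite)
next
  show len: "length a = length b"
    using assms by (simp add: majorizes_def)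
  have take: "sum_list (take m c) = (\<Sum>l<m. c ! l)" if "m \<le> length c" for c :: "nat list" and m
    using that by (simp add: sum_list_sum_nth atLeast0LessThan)
  show "(\<Sum>l<m. b ! l) \<le> (\<Sum>l<m. a ! l)" if "m \<le> length b" for m
  \<comment> \<open>The prefixes in \<open>majorizes\<close> start at length 1, so the empty one is
    treated separately.\<close>
  proof (cases "m = 0")
    case False
    then have "sum_list (take m b) \<le> sum_list (take m a)"
      using assms(1) that len by (auto simp: majorizes_def)
    then show ?thesis
      using take that len by simp
  qed simp
  show "(\<Sum>l<length b. a ! l) = (\<Sum>l<length b. b ! l)"
    using assms(1) take[of "length a" a] take[of "length b" b] len by (simp add: majorizes_def)
qed (use assms in auto)

end

section \<open>Densities in step graphons\<close>

lemma finite_fst_complete_multipartite: "finite (fst (complete_multipartite a))"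
  using finite_simple_graph_complete_multipartite[of a] by (simp add: finite_simple_graph_def)

lemma complete_multipartite_edges:
  "\<forall>e\<in>snd (complete_multipartite a). e \<subseteq> fst (complete_multipartite a) \<and> card e = 2"
  using finite_simple_graph_complete_multipartite[of a] by (simp add: finite_simple_graph_def)

lemma finite_snd_complete_multipartite: "finite (snd (complete_multipartite a))"
proof (rule finite_subset)
  show "snd (complete_multipartite a) \<subseteq> Pow (fst (complete_multipartite a))"
    using complete_multipartite_edges[of a] by blast
qed (simp add: finite_fst_complete_multipartite)

lemma mem_fst_complete_multipartite:
  "v \<in> fst (complete_multipartite a) \<longleftrightarrow> fst v < length a \<and> snd v < a ! fst v"
  by (auto simp: complete_multipartite_def Let_def)

lemma complete_multipartite_edgeI:
  assumes "u \<in> fst (complete_multipartite a)" "v \<in> fst (complete_multipartite a)" "fst u \<noteq> fst v"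
  shows "{u, v} \<in> snd (complete_multipartite a)"
proof -
  have "snd (complete_multipartite a) = {{u, v} | u v. u \<in> fst (complete_multipartite a)
      \<and> v \<in> fst (complete_multipartite a) \<and> fst u \<noteq> fst v}"
    by (simp add: complete_multipartite_def Let_def)
  then show ?thesis using assms by blast
qed

lemma complete_multipartite_edgeE:
  assumes "e \<in> snd (complete_multipartite a)"
  obtains u v where "e = {u, v}" "u \<in> fst (complete_multipartite a)"
    "v \<in> fst (complete_multipartite a)" "fst u \<noteq> fst v"
  using assms unfolding complete_multipartite_def Let_def by auto

lemma card_complete_multipartite_less:
  assumes "i \<le> length a"
  shows "card {v \<in> fst (complete_multipartite a). fst v < i} = (\<Sum>l<i. a ! l)"
proof -
  have "{v \<in> fst (complete_multipartite a). fst v < i} = (SIGMA l:{..<i}. {..<a ! l})"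
    using assms by (auto simp: mem_fst_complete_multipartite)
  then show ?thesis by simp
qed

lemma card_fst_complete_multipartite: "card (fst (complete_multipartite a)) = sum_list a"
proof -
  have "fst (complete_multipartite a) = {v \<in> fst (complete_multipartite a). fst v < length a}"
    by (auto simp: mem_fst_complete_multipartite)
  then show ?thesis
    using card_complete_multipartite_less[of "length a" a]
    by (simp add: sum_list_sum_nth atLeast0LessThan)
qed

text \<open>Exchange argument: members of \<open>J\<close> beyond the first \<open>i\<close>
  positions have entries at most \<open>a ! i\<close>, the first positions missing from
  \<open>J\<close> have entries at least \<open>a ! i\<close>, and the latter are at least as
  many.\<close>

lemma sum_nth_le_prefix_sum:
  fixes a :: "nat list"
  assumes a: "sorted_wrt (\<ge>) a" and J: "J \<subseteq> {..<length a}" "card J \<le> i"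
  shows "(\<Sum>j\<in>J. a ! j) \<le> (\<Sum>j<i. a ! j)"
proof -
  have fin: "finite J" using J by (auto intro: finite_subset)
  have "(\<Sum>j\<in>J - {..<i}. a ! j) \<le> (\<Sum>j\<in>{..<i} - J. a ! j)"
  proof (cases "J \<subseteq> {..<i}")
    case True
    then have "J - {..<i} = {}" by blast
    show ?thesis unfolding \<open>J - {..<i} = {}\<close> by simp
  next
    case False
    \<comment> \<open>Some element of \<open>J\<close> is at least \<open>i\<close>, so the
      threshold \<open>a ! i\<close> is a genuine entry.\<close>
    then have i: "i < length a" using J by force
    have mono: "a ! n \<le> a ! m" if "m \<le> n" "n < length a" for m n
      using a that by (cases "m = n") (auto simp: sorted_wrt_iff_nth_less)
    have "card (J - {..<i}) \<le> card ({..<i} - J)"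
      using J(2) fin by (simp add: card_Diff_subset_Int Int_commute diff_le_mono)
    then have "card (J - {..<i}) * a ! i \<le> card ({..<i} - J) * a ! i"
      by (rule mult_right_mono) simp
    moreover have "(\<Sum>j\<in>J - {..<i}. a ! j) \<le> card (J - {..<i}) * a ! i"
    proof -
      have "a ! j \<le> a ! i" if "j \<in> J - {..<i}" for j
        using that J(1) by (intro mono) auto
      from sum_bounded_above[of "J - {..<i}" "(!) a", OF this] show ?thesis by simp
    qed
    moreover have "card ({..<i} - J) * a ! i \<le> (\<Sum>j\<in>{..<i} - J. a ! j)"
    proof -
      have "a ! i \<le> a ! j" if "j \<in> {..<i} - J" for j
        using that i by (intro mono) auto
      from sum_bounded_below[of "{..<i} - J" _ "(!) a", OF this] show ?thesis by simp
    qed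
    ultimately show ?thesis by linarith
  qed
  moreover have "(\<Sum>j\<in>J. a ! j) = (\<Sum>j\<in>J \<inter> {..<i}. a ! j) + (\<Sum>j\<in>J - {..<i}. a ! j)"
    using fin by (subst sum.Int_Diff[of _ _ "{..<i}"]) auto
  moreover have "(\<Sum>j<i. a ! j) = (\<Sum>j\<in>{..<i} \<inter> J. a ! j) + (\<Sum>j\<in>{..<i} - J. a ! j)"
    by (subst sum.Int_Diff[of _ _ "J"]) auto
  ultimately show ?thesis by (simp add: Int_commute)
qed

lemma nn_integral_PiM_prod_indicator:
  assumes "finite V" "T \<subseteq> V" and S: "\<And>v. v \<in> T \<Longrightarrow> S v \<in> sets unit_measure"
  shows "(\<integral>\<^sup>+x. (\<Prod>v\<in>T. indicator (S v) (x v)) \<partial>PiM V (\<lambda>_. unit_measure))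
       = (\<Prod>v\<in>T. emeasure unit_measure (S v))"
proof -
  interpret sigma_finite_measure unit_measure by (rule sigma_finite_unit_measure)
  interpret product_sigma_finite "\<lambda>_. unit_measure" ..
  \<comment> \<open>Unconstrained coordinates receive the whole interval, which has mass 1.\<close>
  define S' where "S' v = (if v \<in> T then S v else {0..1})" for v
  have S': "S' v \<in> sets unit_measure" for v
    using S sets.top[of unit_measure] by (auto simp: S'_def space_unit_measure)
  have "(\<Prod>v\<in>T. indicator (S v) (x v)) = (\<Prod>v\<in>V. indicator (S' v) (x v) :: ennreal)"
    if "x \<in> space (PiM V (\<lambda>_. unit_measure))" for x
    using assms that
    by (intro prod.mono_neutral_cong_left) (auto simp: S'_def space_PiM space_unit_measure PiE_def Pi_def)
  then have "(\<integral>\<^sup>+x. (\<Prod>v\<in>T. indicator (S v) (x v)) \<partial>PiM V (\<lambda>_. unit_measure))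
      = (\<integral>\<^sup>+x. (\<Prod>v\<in>V. indicator (S' v) (x v)) \<partial>PiM V (\<lambda>_. unit_measure))"
    by (intro nn_integral_cong) simp
  also have "\<dots> = (\<Prod>v\<in>V. emeasure unit_measure (S' v))"
    using assms(1) S' by (subst product_nn_integral_prod) auto
  also have "\<dots> = (\<Prod>v\<in>T. emeasure unit_measure (S v))"
    using assms
    by (intro prod.mono_neutral_cong_right) (auto simp: S'_def emeasure_space_unit_measure)
  finally show ?thesis .
qed

lemma emeasure_unit_measure:
  "S \<in> sets borel \<Longrightarrow> S \<subseteq> {0..1} \<Longrightarrow> emeasure unit_measure S = emeasure lborel S"
  by (simp add: emeasure_restrict_space)

lemma emeasure_unit_measure_eq_measure:
  "emeasure unit_measure S = ennreal (measure unit_measure S)"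
proof (rule emeasure_eq_ennreal_measure)
  have "emeasure unit_measure S \<le> 1"
    using emeasure_space[of unit_measure S] emeasure_space_unit_measure by (simp add: space_unit_measure)
  then show "emeasure unit_measure S \<noteq> top" by (auto simp: top_unique)
qed

lemma sets_unit_measure: "S \<in> sets borel \<Longrightarrow> S \<subseteq> {0..1} \<Longrightarrow> S \<in> sets unit_measure"
  by (simp add: sets_restrict_space_iff)

context
  fixes W assumes W: "graphon W"
begin

lemma edge_product_complete_multipartite_eq_1:
  assumes "\<And>u v. u \<in> fst (complete_multipartite a) \<Longrightarrow> v \<in> fst (complete_multipartite a)
      \<Longrightarrow> fst u \<noteq> fst v \<Longrightarrow> zero_extension W (x u) (x v) = 1"
  shows "edge_product (zero_extension W) (snd (complete_multipartite a)) x = 1"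
  unfolding edge_product_def
proof (intro prod.neutral ballI)
  fix e assume "e \<in> snd (complete_multipartite a)"
  then show "ennreal (edge_value (\<lambda>u v. zero_extension W (x u) (x v)) e) = 1"
    using assms zero_extension_sym[OF W]
    by (elim complete_multipartite_edgeE) (simp add: edge_value_insert)
qed

lemma edge_product_complete_multipartite_eq_0:
  assumes "u \<in> fst (complete_multipartite a)" "v \<in> fst (complete_multipartite a)"
    "fst u \<noteq> fst v" "zero_extension W (x u) (x v) = 0"
  shows "edge_product (zero_extension W) (snd (complete_multipartite a)) x = 0"
  unfolding edge_product_def
proof (rule prod_zero[OF finite_snd_complete_multipartite], rule bexI)
  show "ennreal (edge_value (\<lambda>u v. zero_extension W (x u) (x v)) {u, v}) = 0"
    using assms(4) zero_extension_sym[OF W, of "x u" "x v"] by (subst edge_value_insert) auto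
qed (rule complete_multipartite_edgeI[OF assms(1-3)])

end

section \<open>The indicator of a square\<close>

lemma graphon_box: "graphon (\<lambda>x y. indicator {0..1/2} x * indicator {0..1/2} y)"
proof -
  have B: "indicator {0..1/2} \<in> borel_measurable unit_measure"
    by (intro borel_measurable_indicator sets_unit_measure) auto
  have "(\<lambda>(x, y). indicator {0..1/2} x * indicator {0..1/2} y :: real)
      \<in> borel_measurable (unit_measure \<Otimes>\<^sub>M unit_measure)"
    unfolding case_prod_unfold
    by (intro borel_measurable_times measurable_compose[OF measurable_fst B] measurable_compose[OF measurable_snd B])
  then show ?thesis
    by (simp add: graphon_def indicator_def)
qed

text \<open>With at least two nonempty parts every vertex lies on an edge, so the integrand is 1
  exactly when all vertices land in \<open>{0..1/2}\<close>. The density therefore depends only on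
  the number of vertices.\<close>

lemma hom_density_box:
  assumes "2 \<le> length a" "\<forall>x\<in>set a. 0 < x"
  shows "hom_density (complete_multipartite a) (\<lambda>x y. indicator {0..1/2} x * indicator {0..1/2} y)
       = (1/2) ^ sum_list a"
proof -
  let ?B = "{0..1/2} :: real set"
  let ?V = "fst (complete_multipartite a)"
  let ?W = "\<lambda>x y. indicator {0..1/2} x * indicator {0..1/2} y :: real"
  have eq: "edge_product (zero_extension ?W) (snd (complete_multipartite a)) x = (\<Prod>v\<in>?V. indicator ?B (x v))"
    if "x \<in> space (PiM ?V (\<lambda>_. unit_measure))" for x
  proof -
    have x: "x v \<in> {0..1}" if "v \<in> ?V" for v
      using that \<open>x \<in> _\<close> by (auto simp: space_PiM space_unit_measure)
    show ?thesis
    proof (cases "\<forall>v\<in>?V. x v \<in> ?B")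
      case True
      then show ?thesis
        using x by (subst edge_product_complete_multipartite_eq_1[OF graphon_box])
          (auto simp: zero_extension_def)
    next
      case False
      then obtain v where v: "v \<in> ?V" "x v \<notin> ?B" by auto
      \<comment> \<open>Any part other than that of \<open>v\<close> will do; its vertex
        \<open>(s, 0)\<close> is a neighbour of \<open>v\<close>, and their edge has value
        0.\<close>
      define s where "s = (if fst v = 0 then 1 else 0 :: nat)"
      have "s < length a" "fst v \<noteq> s"
        using assms(1) by (auto simp: s_def)
      then have "(s, 0) \<in> ?V" "fst v \<noteq> fst (s, 0 :: nat)"
        using assms(2) nth_mem[of s a] by (auto simp: mem_fst_complete_multipartite)
      then have "edge_product (zero_extension ?W) (snd (complete_multipartite a)) x = 0"
        using v by (intro edge_product_complete_multipartite_eq_0[OF graphon_box v(1)])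
          (auto simp: zero_extension_def)
      moreover have "(\<Prod>v\<in>?V. indicator ?B (x v)) = (0::ennreal)"
        using v by (intro prod_zero finite_fst_complete_multipartite bexI[of _ v]) auto
      ultimately show ?thesis by simp
    qed
  qed
  have "ennreal (hom_density (complete_multipartite a) ?W)
      = (\<integral>\<^sup>+x. (\<Prod>v\<in>?V. indicator ?B (x v)) \<partial>PiM ?V (\<lambda>_. unit_measure))"
    unfolding ennreal_hom_density[OF graphon_box finite_simple_graph_complete_multipartite]
    by (intro nn_integral_cong eq)
  also have "\<dots> = (\<Prod>v\<in>?V. emeasure unit_measure ?B)"
    by (intro nn_integral_PiM_prod_indicator finite_fst_complete_multipartite sets_unit_measure) auto
  also have "emeasure unit_measure ?B = ennreal (1/2)"
    using emeasure_lborel_Icc[of 0 "1/2"] by (subst emeasure_unit_measure) auto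
  also have "(\<Prod>v\<in>?V. ennreal (1/2)) = ennreal ((1/2) ^ sum_list a)"
    unfolding prod_constant card_fst_complete_multipartite by (rule ennreal_power) simp
  finally show ?thesis
    by (simp add: hom_density_nonneg[OF graphon_box finite_simple_graph_complete_multipartite])
qed

section \<open>Graphons with independent classes\<close>

text \<open>A point outside all classes is joined to every point, itself included, so it can host
  vertices of several parts.\<close>

definition class_graphon :: "(nat \<Rightarrow> real set) \<Rightarrow> nat \<Rightarrow> real \<Rightarrow> real \<Rightarrow> real" where
  "class_graphon C i x y = of_bool (\<not> (\<exists>l<i. x \<in> C l \<and> y \<in> C l))"

lemma graphon_class_graphon:
  assumes C: "\<And>l. l < i \<Longrightarrow> C l \<in> sets unit_measure"
  shows "graphon (class_graphon C i)"
proof -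
  define D where "D = (\<Union>l<i. C l \<times> C l)"
  have D: "D \<in> sets (unit_measure \<Otimes>\<^sub>M unit_measure)"
    unfolding D_def using C by (intro sets.finite_UN pair_measureI) auto
  have "(\<lambda>(x, y). class_graphon C i x y) = (\<lambda>p. 1 - indicator D p)"
    by (auto simp: class_graphon_def D_def indicator_def fun_eq_iff)
  then show ?thesis
    using D by (auto simp: graphon_def class_graphon_def)
qed

context
  fixes C :: "nat \<Rightarrow> real set" and i :: nat and A :: "real set"
  assumes C: "\<And>l. l < i \<Longrightarrow> C l \<in> sets unit_measure"
    and A: "A \<in> sets unit_measure"
begin

text \<open>Where the integrand is nonzero, the vertices outside \<open>A\<close> come from at most
  \<open>i\<close> parts, so at least \<open>sum_list a\<close> minus the first \<open>i\<close>
  entries many vertices lie in \<open>A\<close>. A union bound over the sets of such vertices gives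
  the estimate.\<close>

lemma hom_density_class_graphon_le:
  assumes a: "sorted_wrt (\<ge>) a" and cover: "{0..1} \<subseteq> A \<union> (\<Union>l<i. C l)"
  shows "hom_density (complete_multipartite a) (class_graphon C i)
       \<le> 2 ^ sum_list a * measure unit_measure A ^ (sum_list a - (\<Sum>l<i. a ! l))"
proof -
  let ?V = "fst (complete_multipartite a)"
  let ?n = "sum_list a"
  let ?S = "\<Sum>l<i. a ! l"
  let ?T = "{T. T \<subseteq> ?V \<and> card T = ?n - ?S}"
  let ?W = "class_graphon C i"
  have W: "graphon ?W"
    by (rule graphon_class_graphon) (rule C)
  have finT: "finite ?T"
    by (rule finite_subset[of _ "Pow ?V"]) (auto simp: finite_fst_complete_multipartite)
  have le: "edge_product (zero_extension ?W) (snd (complete_multipartite a)) x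
      \<le> (\<Sum>T\<in>?T. \<Prod>v\<in>T. indicator A (x v))" (is "?e \<le> _")
    if x: "x \<in> space (PiM ?V (\<lambda>_. unit_measure))" for x
  proof (cases "?e = 0")
    case False
    define Z where "Z = {v \<in> ?V. x v \<in> A}"
    have "\<exists>l<i. x v \<in> C l" if "v \<in> ?V - Z" for v
    proof -
      have "x v \<in> {0..1}"
        using that x by (auto simp: space_PiM space_unit_measure)
      then show ?thesis using cover that by (auto simp: Z_def)
    qed
    then obtain cl where cl: "\<And>v. v \<in> ?V - Z \<Longrightarrow> cl v < i \<and> x v \<in> C (cl v)"
      by metis
    \<comment> \<open>\<open>J\<close> collects the parts with a vertex outside \<open>A\<close>,
      and \<open>r\<close> picks one such vertex from each.\<close>
    define J where "J = fst ` (?V - Z)"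
    have "\<exists>v. v \<in> ?V - Z \<and> fst v = j" if "j \<in> J" for j
      using that by (auto simp: J_def)
    then obtain r where r: "\<And>j. j \<in> J \<Longrightarrow> r j \<in> ?V - Z \<and> fst (r j) = j"
      by metis
    \<comment> \<open>Representatives of two parts are adjacent; in a common class their edge would
      have value 0.\<close>
    have "inj_on (cl \<circ> r) J"
    proof (rule inj_onI, rule ccontr)
      fix j j' assume j: "j \<in> J" "j' \<in> J" "(cl \<circ> r) j = (cl \<circ> r) j'" "j \<noteq> j'"
      then have "?e = 0"
        using r[of j] r[of j'] cl[of "r j"] cl[of "r j'"]
        by (intro edge_product_complete_multipartite_eq_0[OF W, of "r j" _ "r j'"])
          (auto simp: zero_extension_def class_graphon_def)
      then show False using False by simp
    qed
    moreover have "(cl \<circ> r) ` J \<subseteq> {..<i}"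
    proof (rule image_subsetI)
      fix j assume "j \<in> J"
      then show "(cl \<circ> r) j \<in> {..<i}"
        using r[of j] cl[of "r j"] by simp
    qed
    ultimately have "card J \<le> i"
      using card_inj_on_le[of "cl \<circ> r" J "{..<i}"] by simp
    moreover have J: "J \<subseteq> {..<length a}"
      by (auto simp: J_def mem_fst_complete_multipartite)
    ultimately have "(\<Sum>j\<in>J. a ! j) \<le> ?S"
      by (intro sum_nth_le_prefix_sum[OF a])
    moreover have "card (?V - Z) \<le> (\<Sum>j\<in>J. a ! j)"
    proof -
      have finJ: "finite J" using J by (auto intro: finite_subset)
      have "?V - Z \<subseteq> (SIGMA j:J. {..<a ! j})"
        by (force simp: J_def mem_fst_complete_multipartite)
      then have "card (?V - Z) \<le> card (SIGMA j:J. {..<a ! j})"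
        using finJ by (intro card_mono) auto
      then show ?thesis using finJ by simp
    qed
    moreover have "card (?V - Z) = ?n - card Z"
      by (subst card_Diff_subset)
        (auto simp: Z_def finite_fst_complete_multipartite card_fst_complete_multipartite)
    ultimately have "?n - ?S \<le> card Z" by linarith
    then obtain T where T: "T \<subseteq> Z" "card T = ?n - ?S"
      by (rule obtain_subset_with_card_n)
    have "?e \<le> 1"
      by (rule edge_product_zero_extension_le_1[OF W complete_multipartite_edges])
    also have "1 = (\<Prod>v\<in>T. indicator A (x v) :: ennreal)"
    proof -
      have "indicator A (x v) = (1 :: ennreal)" if "v \<in> T" for v
        using T(1) that by (auto simp: Z_def)
      then show ?thesis by simp
    qed
    also have "\<dots> \<le> (\<Sum>T\<in>?T. \<Prod>v\<in>T. indicator A (x v))"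
    proof (rule member_le_sum)
      show "T \<in> ?T" using T by (auto simp: Z_def)
    qed (simp_all add: finT)
    finally show ?thesis .
  qed simp
  have "ennreal (hom_density (complete_multipartite a) ?W)
      \<le> (\<integral>\<^sup>+x. (\<Sum>T\<in>?T. \<Prod>v\<in>T. indicator A (x v)) \<partial>PiM ?V (\<lambda>_. unit_measure))"
    unfolding ennreal_hom_density[OF W finite_simple_graph_complete_multipartite]
    by (intro nn_integral_mono le)
  also have "\<dots> = (\<Sum>T\<in>?T. \<integral>\<^sup>+x. (\<Prod>v\<in>T. indicator A (x v)) \<partial>PiM ?V (\<lambda>_. unit_measure))"
  proof (rule nn_integral_sum)
    fix T assume T: "T \<in> ?T"
    have "(\<lambda>x. indicator A (x v) :: ennreal) \<in> borel_measurable (PiM ?V (\<lambda>_. unit_measure))" if "v \<in> T" for v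
    proof (rule measurable_compose[OF _ borel_measurable_indicator[OF A]])
      show "(\<lambda>x. x v) \<in> measurable (PiM ?V (\<lambda>_. unit_measure)) unit_measure"
        using T that by (intro measurable_component_singleton) auto
    qed
    then show "(\<lambda>x. \<Prod>v\<in>T. indicator A (x v) :: ennreal) \<in> borel_measurable (PiM ?V (\<lambda>_. unit_measure))"
      by (rule borel_measurable_prod_ennreal)
  qed
  also have "\<dots> = (\<Sum>T\<in>?T. emeasure unit_measure A ^ (?n - ?S))"
  proof (rule sum.cong)
    fix T assume T: "T \<in> ?T"
    show "(\<integral>\<^sup>+x. (\<Prod>v\<in>T. indicator A (x v)) \<partial>PiM ?V (\<lambda>_. unit_measure)) = emeasure unit_measure A ^ (?n - ?S)"
      using T A by (subst nn_integral_PiM_prod_indicator) (simp_all add: finite_fst_complete_multipartite)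
  qed simp
  also have "\<dots> = of_nat (card ?T) * emeasure unit_measure A ^ (?n - ?S)"
    by simp
  \<comment> \<open>All vertex subsets are counted; only the power of the measure of
    \<open>A\<close> matters later.\<close>
  also have "\<dots> \<le> 2 ^ ?n * emeasure unit_measure A ^ (?n - ?S)"
  proof (intro mult_right_mono)
    have "card ?T \<le> card (Pow ?V)"
      by (intro card_mono) (auto simp: finite_fst_complete_multipartite)
    then have "card ?T \<le> 2 ^ ?n"
      by (simp add: card_Pow finite_fst_complete_multipartite card_fst_complete_multipartite)
    then have "of_nat (card ?T) \<le> (of_nat (2 ^ ?n) :: ennreal)"
      by (rule of_nat_mono)
    then show "of_nat (card ?T) \<le> (2 ^ ?n :: ennreal)" by simp
  qed simp
  also have "emeasure unit_measure A = ennreal (measure unit_measure A)"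
    by (rule emeasure_unit_measure_eq_measure)
  also have "2 ^ ?n * ennreal (measure unit_measure A) ^ (?n - ?S)
      = ennreal (2 ^ ?n * measure unit_measure A ^ (?n - ?S))"
  proof -
    have "(2 :: ennreal) ^ ?n = ennreal (2 ^ ?n)"
      using ennreal_power[of 2 ?n] by simp
    then show ?thesis
      by (simp only: ennreal_power measure_nonneg ennreal_mult zero_le_power zero_le_numeral)
  qed
  finally show ?thesis by (subst (asm) ennreal_le_iff) auto
qed

text \<open>Only placements with part \<open>l < i\<close> inside \<open>C l\<close> and all other
  parts inside \<open>A\<close> are kept. There no class contains two adjacent vertices, so the
  integrand is 1, and the measure of this product set is computed coordinatewise.\<close>

lemma hom_density_class_graphon_ge:
  assumes disj: "\<And>l m. l < i \<Longrightarrow> m < i \<Longrightarrow> l \<noteq> m \<Longrightarrow> C l \<inter> C m = {}" "\<And>l. l < i \<Longrightarrow> C l \<inter> A = {}"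
    and i: "i \<le> length a"
    and size: "\<And>l. l < i \<Longrightarrow> \<delta> \<le> measure unit_measure (C l)" and \<delta>: "0 \<le> \<delta>" "\<delta> \<le> 1"
  shows "\<delta> ^ sum_list a * measure unit_measure A ^ (sum_list a - (\<Sum>l<i. a ! l))
       \<le> hom_density (complete_multipartite a) (class_graphon C i)"
proof -
  let ?V = "fst (complete_multipartite a)"
  let ?W = "class_graphon C i"
  let ?D = "\<lambda>v. if fst v < i then C (fst v) else A"
  have W: "graphon ?W"
    by (rule graphon_class_graphon) (rule C)
  have D: "?D v \<in> sets unit_measure" for v :: "nat \<times> nat"
    using A C by auto
  have D01: "?D v \<subseteq> {0..1}" for v :: "nat \<times> nat"
    using sets.sets_into_space[OF D, of v] by (simp only: space_unit_measure)
  have ge: "(\<Prod>v\<in>?V. indicator (?D v) (x v)) \<le> edge_product (zero_extension ?W) (snd (complete_multipartite a)) x" for x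
  proof (cases "\<forall>v\<in>?V. x v \<in> ?D v")
    case True
    have "zero_extension ?W (x u) (x v) = 1" if uv: "u \<in> ?V" "v \<in> ?V" "fst u \<noteq> fst v" for u v
    proof -
      have m: "x u \<in> ?D u" "x v \<in> ?D v" using True uv by auto
      then have "x u \<in> {0..1}" "x v \<in> {0..1}" using D01[of u] D01[of v] by blast+
      moreover have "\<not> (\<exists>l<i. x u \<in> C l \<and> x v \<in> C l)"
      proof
        assume "\<exists>l<i. x u \<in> C l \<and> x v \<in> C l"
        then obtain l where l: "l < i" "x u \<in> C l" "x v \<in> C l" by auto
        have "fst u = l" using l m(1) disj(1)[of "fst u" l] disj(2)[of l] by (auto split: if_splits)
        moreover have "fst v = l" using l m(2) disj(1)[of "fst v" l] disj(2)[of l] by (auto split: if_splits)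
        ultimately show False using uv by simp
      qed
      ultimately show ?thesis by (simp add: zero_extension_def class_graphon_def)
    qed
    then have "edge_product (zero_extension ?W) (snd (complete_multipartite a)) x = 1"
      by (intro edge_product_complete_multipartite_eq_1[OF W])
    moreover have "(\<Prod>v\<in>?V. indicator (?D v) (x v)) = (1 :: ennreal)"
      using True by (intro prod.neutral) auto
    ultimately show ?thesis by simp
  next
    case False
    then obtain v where v: "v \<in> ?V" "x v \<notin> ?D v" by blast
    then have "(\<Prod>v\<in>?V. indicator (?D v) (x v)) = (0 :: ennreal)"
      by (intro prod_zero finite_fst_complete_multipartite bexI[of _ v] indicator_simps(2))
    then show ?thesis by (simp only: zero_le)
  qed
  let ?c = "\<lambda>v :: nat \<times> nat. if fst v < i then 1 else measure unit_measure A"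
  let ?U = "?V \<inter> - {v. fst v < i}"
  have "card (?V \<inter> {v. fst v < i}) = (\<Sum>l<i. a ! l)"
    using card_complete_multipartite_less[OF i] by (simp add: Int_def)
  moreover have "card ?V = card (?V \<inter> {v. fst v < i}) + card ?U"
  proof -
    have "?V = (?V \<inter> {v. fst v < i}) \<union> ?U" by blast
    moreover have "card ((?V \<inter> {v. fst v < i}) \<union> ?U) = card (?V \<inter> {v. fst v < i}) + card ?U"
      by (rule card_Un_disjoint) (simp add: finite_fst_complete_multipartite, simp add: finite_fst_complete_multipartite, blast)
    ultimately show ?thesis by argo
  qed
  ultimately have card_U: "card ?U = sum_list a - (\<Sum>l<i. a ! l)"
    by (simp add: card_fst_complete_multipartite)
  have "(\<Prod>v\<in>?V. ?c v) = measure unit_measure A ^ card ?U"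
    by (subst prod.If_cases[OF finite_fst_complete_multipartite]) simp
  then have "\<delta> ^ sum_list a * measure unit_measure A ^ (sum_list a - (\<Sum>l<i. a ! l))
      = (\<Prod>v\<in>?V. \<delta> * ?c v)"
    by (simp add: prod.distrib card_fst_complete_multipartite card_U)
  also have "\<dots> \<le> (\<Prod>v\<in>?V. measure unit_measure (?D v))"
  proof (rule prod_mono)
    fix v :: "nat \<times> nat"
    \<comment> \<open>For uniformity every vertex pays a factor \<open>\<delta>\<close>; for those
      in \<open>A\<close> this only lowers the bound, as \<open>\<delta> \<le> 1\<close>.\<close>
    have "\<delta> * measure unit_measure A \<le> measure unit_measure A"
      using \<delta> by (intro mult_left_le_one_le) auto
    then show "0 \<le> \<delta> * ?c v \<and> \<delta> * ?c v \<le> measure unit_measure (?D v)"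
      using \<delta> size[of "fst v"] by simp
  qed
  finally have "ennreal (\<delta> ^ sum_list a * measure unit_measure A ^ (sum_list a - (\<Sum>l<i. a ! l)))
      \<le> ennreal (\<Prod>v\<in>?V. measure unit_measure (?D v))"
    by (rule ennreal_leI)
  also have "\<dots> = (\<Prod>v\<in>?V. emeasure unit_measure (?D v))"
    by (simp only: emeasure_unit_measure_eq_measure) (simp add: prod_ennreal)
  also have "\<dots> = (\<integral>\<^sup>+x. (\<Prod>v\<in>?V. indicator (?D v) (x v)) \<partial>PiM ?V (\<lambda>_. unit_measure))"
    using D by (intro nn_integral_PiM_prod_indicator[symmetric] finite_fst_complete_multipartite) auto
  also have "\<dots> \<le> ennreal (hom_density (complete_multipartite a) ?W)"
    unfolding ennreal_hom_density[OF W finite_simple_graph_complete_multipartite]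
    by (intro nn_integral_mono ge)
  finally show ?thesis
    by (simp add: hom_density_nonneg[OF W finite_simple_graph_complete_multipartite])
qed

end

section \<open>A separating graphon when a prefix inequality fails\<close>

text \<open>The upper bound for \<open>a\<close> carries at least one more factor
  \<open>\<epsilon>\<close> than the lower bound for \<open>b\<close>, so it is the smaller one once
  \<open>2 ^ n * \<epsilon> < \<delta> ^ n\<close>.\<close>

lemma exists_graphon_hom_density_less:
  assumes a: "sorted_wrt (\<ge>) a" and b: "sorted_wrt (\<ge>) b" "\<forall>x\<in>set b. 0 < x"
    and len: "length b = length a" and total: "sum_list a = sum_list b"
    and i: "0 < i" "i < length a" and less: "(\<Sum>l<i. a ! l) < (\<Sum>l<i. b ! l)"
  shows "\<exists>W. graphon W \<and> hom_density (complete_multipartite a) W < hom_density (complete_multipartite b) W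
      \<and> hom_density (complete_multipartite b) W < 1"
proof -
  define n where "n = sum_list b"
  define Sa where "Sa = (\<Sum>l<i. a ! l)"
  define Sb where "Sb = (\<Sum>l<i. b ! l)"
  \<comment> \<open>A positive part beyond the first \<open>i\<close> makes \<open>n - Sb\<close>
    positive, which will keep the density of \<open>b\<close> below 1.\<close>
  have "(\<Sum>l<i. b ! l) + b ! i = (\<Sum>l<Suc i. b ! l)"
    by simp
  also have "\<dots> \<le> (\<Sum>l<length b. b ! l)"
    using i len by (intro sum_mono2) auto
  also have "\<dots> = n"
    by (simp add: n_def sum_list_sum_nth atLeast0LessThan)
  finally have "Sb + b ! i \<le> n" by (simp add: Sb_def)
  moreover have "0 < b ! i"
    using b(2) i len by simp
  ultimately have Sb: "Sb < n" by simp
  have Sab: "Sa < Sb" using less by (simp add: Sa_def Sb_def)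
  \<comment> \<open>\<open>\<delta>\<close> is half the length of an interval of the partition into
    \<open>i\<close> pieces, so a class keeps measure \<open>\<delta>\<close> after losing at most
    \<open>\<epsilon> \<le> \<delta>\<close> to \<open>A\<close>. \<open>\<epsilon>\<close> is half
    the value at which \<open>2 ^ n * \<epsilon> = \<delta> ^ n\<close>.\<close>
  define \<delta> :: real where "\<delta> = 1 / (2 * i)"
  define \<epsilon> :: real where "\<epsilon> = (\<delta> / 2) ^ n / 2"
  have \<delta>: "0 < \<delta>" "\<delta> \<le> 1 / 2"
    using i by (auto simp: \<delta>_def field_simps)
  have \<epsilon>: "0 < \<epsilon>" "2 ^ n * \<epsilon> < \<delta> ^ n"
    using \<delta> by (auto simp: \<epsilon>_def power_divide)
  have "(\<delta> / 2) ^ n \<le> (\<delta> / 2) ^ 1"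
    using \<delta> Sb by (intro power_decreasing) auto
  then have \<epsilon>_le: "\<epsilon> \<le> \<delta>" "\<epsilon> \<le> 1"
    using \<delta> by (auto simp: \<epsilon>_def)
  define A where "A = {0..\<epsilon>}"
  define C where "C l = {max \<epsilon> (real l / i) <.. real (Suc l) / i}" for l
  have C01: "C l \<subseteq> {0..1}" if "l < i" for l
  proof
    fix x assume "x \<in> C l"
    then have "0 \<le> x" "x \<le> real (Suc l) / i"
      using \<epsilon>(1) by (auto simp: C_def)
    moreover have "real (Suc l) / i \<le> 1"
      using that by (simp add: field_simps)
    ultimately show "x \<in> {0..1}" by auto
  qed
  have C: "C l \<in> sets unit_measure" if "l < i" for l
    using C01[OF that] by (intro sets_unit_measure) (auto simp: C_def)
  have A: "A \<in> sets unit_measure"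
    using \<epsilon>_le by (intro sets_unit_measure) (auto simp: A_def)
  have measA: "measure unit_measure A = \<epsilon>"
    using \<epsilon> \<epsilon>_le by (simp add: measure_def emeasure_unit_measure A_def)
  have measC: "\<delta> \<le> measure unit_measure (C l)" if "l < i" for l
  proof -
    have "max \<epsilon> (real l / i) \<le> real l / i + \<delta>"
      using \<epsilon>_le \<delta> by (simp add: max_def add_increasing)
    moreover have "real (Suc l) / i = real l / i + 2 * \<delta>"
      using i by (simp add: \<delta>_def field_simps)
    ultimately have ge: "\<delta> \<le> real (Suc l) / i - max \<epsilon> (real l / i)"
      by linarith
    then have "emeasure unit_measure (C l) = ennreal (real (Suc l) / i - max \<epsilon> (real l / i))"
      using C01[OF that] \<delta> unfolding C_def
      by (subst emeasure_unit_measure) (auto intro!: emeasure_lborel_Ioc)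
    then have "measure unit_measure (C l) = real (Suc l) / i - max \<epsilon> (real l / i)"
      using ge \<delta> by (intro measure_eq_emeasure_eq_ennreal) linarith+
    then show ?thesis using ge by simp
  qed
  have cover: "{0..1} \<subseteq> A \<union> (\<Union>l<i. C l)"
  proof
    fix x :: real assume x: "x \<in> {0..1}"
    show "x \<in> A \<union> (\<Union>l<i. C l)"
    proof (cases "x \<le> \<epsilon>")
      case False
      \<comment> \<open>The index with \<open>l < x * i \<le> l + 1\<close>; the ceiling matches
        intervals that are open on the left and closed on the right.\<close>
      define l where "l = nat (\<lceil>x * i\<rceil> - 1)"
      have pos: "0 < x * i" using False \<epsilon> i by simp
      then have "1 \<le> \<lceil>x * i\<rceil>" by linarith
      then have l: "real l = \<lceil>x * i\<rceil> - 1"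
        by (simp add: l_def)
      have bounds: "real l < x * i" "x * i \<le> real l + 1"
        unfolding l by linarith+
      have "x * i \<le> i" using x by (simp add: mult_left_le_one_le)
      then have "real l < i" using bounds by linarith
      moreover have "x \<in> C l"
        using bounds False i by (auto simp: C_def field_simps)
      ultimately show ?thesis by auto
    qed (use x in \<open>simp add: A_def\<close>)
  qed
  have disj: "C l \<inter> C m = {}" if "l \<noteq> m" for l m
  proof -
    have "C l \<inter> C m = {}" if "l < m" for l m
    proof -
      have "real (Suc l) / i \<le> real m / i"
        using that i by (intro divide_right_mono) auto
      then show ?thesis by (auto simp: C_def)
    qed
    from this[of l m] this[of m l] show ?thesis
      using that by (cases "l < m") (auto simp: Int_commute)
  qed
  have disjA: "C l \<inter> A = {}" for l
    by (auto simp: C_def A_def)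
  let ?W = "class_graphon C i"
  have le: "hom_density (complete_multipartite c) ?W \<le> 2 ^ n * \<epsilon> ^ (n - (\<Sum>l<i. c ! l))"
    if "sorted_wrt (\<ge>) c" "sum_list c = n" for c
    using hom_density_class_graphon_le[OF C A that(1) cover] that(2) by (simp add: measA)
  have ge: "\<delta> ^ n * \<epsilon> ^ (n - Sb) \<le> hom_density (complete_multipartite b) ?W"
  proof -
    have "\<delta> ^ sum_list b * measure unit_measure A ^ (sum_list b - (\<Sum>l<i. b ! l))
        \<le> hom_density (complete_multipartite b) ?W"
      using i len \<delta> by (intro hom_density_class_graphon_ge C A disj disjA measC) auto
    then show ?thesis by (simp only: measA n_def Sb_def)
  qed
  have "hom_density (complete_multipartite a) ?W \<le> 2 ^ n * \<epsilon> ^ (n - Sa)"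
    using le[OF a] total by (simp add: n_def Sa_def)
  \<comment> \<open>From \<open>Sa < Sb < n\<close> the exponent \<open>n - Sa\<close> is at least
    \<open>Suc (n - Sb)\<close>, and \<open>\<epsilon> \<le> 1\<close>.\<close>
  also have "\<dots> \<le> 2 ^ n * \<epsilon> ^ Suc (n - Sb)"
    using Sab Sb \<epsilon> \<epsilon>_le by (intro mult_left_mono power_decreasing) auto
  also have "\<dots> = (2 ^ n * \<epsilon>) * \<epsilon> ^ (n - Sb)"
    by simp
  also have "\<dots> < \<delta> ^ n * \<epsilon> ^ (n - Sb)"
    using \<epsilon> by (intro mult_strict_right_mono) auto
  also note ge
  finally have 1: "hom_density (complete_multipartite a) ?W < hom_density (complete_multipartite b) ?W" .
  have "hom_density (complete_multipartite b) ?W \<le> 2 ^ n * \<epsilon> ^ (n - Sb)"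
    using le[OF b(1)] by (simp add: n_def Sb_def)
  also have "\<dots> \<le> 2 ^ n * \<epsilon> ^ 1"
    using Sb \<epsilon> \<epsilon>_le by (intro mult_left_mono power_decreasing) auto
  also have "\<dots> < \<delta> ^ n" using \<epsilon> by simp
  also have "\<dots> \<le> 1" using \<delta> by (intro power_le_one) auto
  finally have 2: "hom_density (complete_multipartite b) ?W < 1" .
  show ?thesis
    using 1 2 C by (intro exI[of _ ?W] conjI graphon_class_graphon)
qed

section \<open>From densities to the exponent\<close>

lemma density_domination_exponent_eq_1:
  assumes a: "2 \<le> length a" "\<forall>x\<in>set a. 0 < x" and b: "\<forall>x\<in>set b. 0 < x" "sorted_wrt (\<ge>) b"
    and maj: "majorizes a b"
  shows "density_domination_exponent (complete_multipartite b) (complete_multipartite a) = 1"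
  unfolding density_domination_exponent_def
proof (rule antisym)
  let ?a = "hom_density (complete_multipartite a)" and ?b = "hom_density (complete_multipartite b)"
  show "(SUP W\<in>{W. graphon W \<and> ?b W \<noteq> 0 \<and> ?b W \<noteq> 1}.
      if ?a W = 0 then \<infinity> else ennreal (ln (?a W) / ln (?b W))) \<le> 1"
  proof (rule SUP_least)
    fix W assume "W \<in> {W. graphon W \<and> ?b W \<noteq> 0 \<and> ?b W \<noteq> 1}"
    then have W: "graphon W" and b': "?b W \<noteq> 0" "?b W \<noteq> 1" by auto
    have "0 < ?b W" "?b W < 1"
      using hom_density_nonneg[OF W finite_simple_graph_complete_multipartite, of b]
        hom_density_le_1[OF W finite_simple_graph_complete_multipartite, of b] b' by auto
    moreover have "?b W \<le> ?a W"
      by (rule hom_density_complete_multipartite_mono[OF W maj b(2)])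
    ultimately have "?a W \<noteq> 0" "ln (?b W) < 0" "ln (?b W) \<le> ln (?a W)"
      by auto
    \<comment> \<open>The denominator is negative, so \<open>ln (?b W) \<le> ln (?a W)\<close>
      bounds the quotient above by 1.\<close>
    then show "(if ?a W = 0 then \<infinity> else ennreal (ln (?a W) / ln (?b W))) \<le> 1"
      by (auto simp: divide_le_eq)
  qed
  let ?W = "\<lambda>x y. indicator {0..1/2} x * indicator {0..1/2} y :: real"
  have len: "length b = length a" and total: "sum_list b = sum_list a"
    using maj by (auto simp: majorizes_def)
  have "a ! 0 \<in> set a" using a by (intro nth_mem) auto
  then have "0 < a ! 0" "a ! 0 \<le> sum_list a"
    using a(2) by (blast, intro member_le_sum_list) auto
  then have "(1/2 :: real) ^ sum_list a < 1"
    using power_strict_decreasing[of 0 "sum_list a" "1/2 :: real"] by simp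
  moreover have "(1/2 :: real) ^ sum_list a \<noteq> 0" by simp
  moreover have "?a ?W = (1/2) ^ sum_list a" "?b ?W = (1/2) ^ sum_list a"
    using hom_density_box[of a] hom_density_box[of b] a b len total by auto
  ultimately have W: "?W \<in> {W. graphon W \<and> ?b W \<noteq> 0 \<and> ?b W \<noteq> 1}"
    and eq: "1 = (if ?a ?W = 0 then \<infinity> else ennreal (ln (?a ?W) / ln (?b ?W)))"
    using graphon_box by auto
  show "1 \<le> (SUP W\<in>{W. graphon W \<and> ?b W \<noteq> 0 \<and> ?b W \<noteq> 1}.
      if ?a W = 0 then \<infinity> else ennreal (ln (?a W) / ln (?b W)))"
    unfolding eq by (rule SUP_upper[OF W])
qed

text \<open>A single graphon suffices: either the density of \<open>a\<close> vanishes and the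
  quotient is infinite by convention, or both logarithms are negative and the numerator is the
  larger in absolute value.\<close>

lemma density_domination_exponent_gt_1:
  assumes W: "graphon W" and less: "hom_density (complete_multipartite a) W < hom_density (complete_multipartite b) W"
    and "hom_density (complete_multipartite b) W < 1"
  shows "1 < density_domination_exponent (complete_multipartite b) (complete_multipartite a)"
  unfolding density_domination_exponent_def
proof (rule less_SUP_iff[THEN iffD2], rule bexI)
  let ?a = "hom_density (complete_multipartite a)" and ?b = "hom_density (complete_multipartite b)"
  have nonneg: "0 \<le> ?a W"
    by (rule hom_density_nonneg[OF W finite_simple_graph_complete_multipartite])
  then show "W \<in> {W. graphon W \<and> ?b W \<noteq> 0 \<and> ?b W \<noteq> 1}"
    using assms by auto
  show "1 < (if ?a W = 0 then \<infinity> else ennreal (ln (?a W) / ln (?b W)))"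
  proof (cases "?a W = 0")
    case False
    then have "ln (?a W) < ln (?b W)" "ln (?b W) < 0"
      using nonneg assms by auto
    then have "1 < ln (?a W) / ln (?b W)"
      by (simp add: less_divide_eq)
    then show ?thesis using False by (simp add: ennreal_less_iff flip: ennreal_1)
  qed simp
qed

theorem theorem5p5:
  fixes k :: nat and a b :: "nat list"
  assumes "2 \<le> k"
    and "length a = k" and "length b = k"
    and "\<forall>x\<in>set a. 0 < x" and "\<forall>x\<in>set b. 0 < x"
    and "sorted_wrt (\<ge>) a" and "sorted_wrt (\<ge>) b"
  shows "(majorizes a b \<longrightarrow>
           density_domination_exponent (complete_multipartite b) (complete_multipartite a) = 1)
       \<and> (sum_list a = sum_list b \<longrightarrow>
           (density_domination_exponent (complete_multipartite b) (complete_multipartite a) = 1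
              \<longleftrightarrow> majorizes a b))"
proof -
  have "majorizes a b \<Longrightarrow>
      density_domination_exponent (complete_multipartite b) (complete_multipartite a) = 1"
    using assms by (intro density_domination_exponent_eq_1) auto
  moreover have "majorizes a b"
    if total: "sum_list a = sum_list b"
      and eq_1: "density_domination_exponent (complete_multipartite b) (complete_multipartite a) = 1"
  proof (rule ccontr)
    assume "\<not> majorizes a b"
    then obtain i where i: "1 \<le> i" "i \<le> k" "sum_list (take i a) < sum_list (take i b)"
      using assms total by (auto simp: majorizes_def not_le)
    \<comment> \<open>With equal totals the violated inequality belongs to a proper prefix, so
      \<open>b\<close> has a part beyond it.\<close>
    then have "i \<noteq> k" using assms total by auto
    moreover have "sum_list (take i c) = (\<Sum>l<i. c ! l)" if "length c = k" for c :: "nat list"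
      using that i by (simp add: sum_list_sum_nth atLeast0LessThan)
    ultimately obtain W where "graphon W"
      "hom_density (complete_multipartite a) W < hom_density (complete_multipartite b) W"
      "hom_density (complete_multipartite b) W < 1"
      using exists_graphon_hom_density_less[of a b i] assms total i by auto
    then show False
      using density_domination_exponent_gt_1[of W a b] eq_1 by simp
  qed
  ultimately show ?thesis by blast
qed

end
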